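(* Let $P$ be a holomorphic polynomial on $\mathbb{C}^2$ and let $M:=\{(z_1,z_2)\in\mathbb{C}^2 : |P(z_1,z_2)|=1\}$, with $dP(z)\neq 0$ for all $z\in M$. Let $K\subset M$ be compact and simply-coconnected. If $P^{-1}\{c\}\cap K$ is polynomially convex for every $c\in\partial\mathbb{D}$, then $K$ is polynomially convex.
   Context: $\mathbb{D}$ is the open unit disc in $\mathbb{C}$. A compact set $K\subset\mathbb{C}^n$ is simply-coconnected if for every continuous map $f:K\to\mathbb{C}\setminus\{0\}$ there is a continuous map $\psi:K\to\mathbb{C}$ with $f=\exp(\psi)$ (equivalently, $\check{H}^1(K;\mathbb{Z})=0$). For a compact $K\subset\mathbb{C}^n$, $\widehat{K}:=\{z\in\mathbb{C}^n : |p(z)|\le \sup_K|p| \text{ for all holomorphic polynomials } p\}$, and $K$ is polynomially convex if $\widehat{K}=K$. *)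

theory Defs
  imports "HOL-Analysis.Analysis"
begin

definition hpoly2 :: "(complex \<times> complex \<Rightarrow> complex) \<Rightarrow> bool" where
  "hpoly2 p \<longleftrightarrow> (\<exists>(N::nat) (c::nat \<Rightarrow> nat \<Rightarrow> complex).
      \<forall>z. p z = (\<Sum>i\<le>N. \<Sum>j\<le>N. c i j * fst z ^ i * snd z ^ j))"

text \<open>Polynomial hull: z with |p(z)| \<le> sup_K |p| for all holomorphic polynomials p
  (phrased with upper bounds t so that the empty set is handled correctly).\<close>
definition poly_hull :: "(complex \<times> complex) set \<Rightarrow> (complex \<times> complex) set" where
  "poly_hull K = {z. \<forall>p. hpoly2 p \<longrightarrow>
      (\<forall>t::real. (\<forall>w\<in>K. norm (p w) \<le> t) \<longrightarrow> norm (p z) \<le> t)}"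

definition polynomially_convex :: "(complex \<times> complex) set \<Rightarrow> bool" where
  "polynomially_convex K \<longleftrightarrow> poly_hull K = K"

definition simply_coconnected :: "(complex \<times> complex) set \<Rightarrow> bool" where
  "simply_coconnected K \<longleftrightarrow> (\<forall>f::complex \<times> complex \<Rightarrow> complex. continuous_on K f \<and> f ` K \<subseteq> - {0} \<longrightarrow>
      (\<exists>\<psi>::complex \<times> complex \<Rightarrow> complex. continuous_on K \<psi> \<and> (\<forall>z\<in>K. f z = exp (\<psi> z))))"

end

theory Submission
  imports Defs "HOL-Complex_Analysis.Complex_Analysis"
begin

text \<open>Let L be the hull of K. Peak functions in P and the convexity of the fibres give
  L \<inter> {|P| = 1} = K, so a point of L - K would satisfy |P| < 1, and then L meets every circle
  |P| = r with r < 1 close to 1. A logarithm of P on K extends to a continuous \<phi> with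
  P = exp \<phi> on the part of L over \<rho> \<le> |P| \<le> 1, for some \<rho> < 1. With \<kappa> = - pi / ln \<rho>, the function
  Re (- i exp (- i \<kappa> \<phi>)) = - exp (\<kappa> Im \<phi>) sin (\<kappa> ln |P|) is positive over \<rho> < |P| < 1 and vanishes
  over |P| = \<rho> and |P| = 1. So its maximum is attained over the open annulus, where it is locally
  the real part of a holomorphic function of P. This contradicts the local maximum principle for
  hulls.

  The maximum principle is proved on L over a disc |g| < r with g polynomial: if |f| < 1 on L over
  |g| = r and on K over |g| \<le> r, the spectral radius formula shows that high powers of f are congruent modulo g - l,
  for |l| = r, to polynomials that are small on K, and a Cauchy sum over roots of unity produces a
  polynomial that is bounded on K but comparable to a power of f inside the disc. Bidiscs then
  follow by using the two coordinates for g.\<close>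

section \<open>Spectra in seminormed algebras\<close>

text \<open>A harmonic function on a closed annulus that vanishes on both boundary circles is zero,
  so no harmonic function of P alone can serve at the end. The strip
  \<open>ln \<rho> \<le> Re s \<le> 0\<close>, which covers the annulus through exp, does carry a
  positive one: \<kappa> is pi divided by the width of the strip, so
  \<open>exp (- \<i> * \<kappa> * s)\<close> sends it into the closed upper half plane with both
  edges on the real axis, and the factor \<open>- \<i>\<close> turns imaginary parts into real
  parts. This function is unbounded and not periodic in Im s. Hence it descends to the hull only
  through a single-valued logarithm \<phi>, which is what the hypothesis on K supplies, and it has a
  maximum there only because the hull is compact.

  The second obstacle is the spectral theory behind the maximum principle. No completion is formed:
  "a is invertible" becomes "some x makes the size of \<open>1 - a * x\<close> less than 1", and
  truncated Neumann series do the rest. The spectral radius formula and the Gelfand-Mazur argument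
  are proved in this form, with averages over roots of unity in place of contour integrals.\<close>

lemma roots_of_unity_sum:
  fixes n :: nat
  assumes "0 < n" "0 < j" "j < n"
  shows "(\<Sum>i<n. (cis (2 * pi * real i / real n)) ^ j) = 0"
proof -
  define w where "w = cis (2 * pi * real j / real n)"
  have "(\<Sum>i<n. (cis (2 * pi * real i / real n)) ^ j) = (\<Sum>i<n. w ^ i)"
    by (simp add: w_def Complex.DeMoivre mult_ac)
  moreover have "w ^ n = 1"
    using assms by (simp add: w_def Complex.DeMoivre cis_multiple_2pi)
  moreover have "w \<noteq> 1"
  proof
    assume "w = 1"
    then have "cos (2 * pi * (j / n)) = 1" by (simp add: w_def complex_eq_iff)
    then obtain k::int where k: "2 * pi * (j / n) = k * (2 * pi)"
      by (auto simp: cos_one_2pi_int mult_ac)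
    then have "real j / n = k"
      using mult_cancel_left[of "2 * pi" "real j / real n" "of_int k"] by (simp add: mult_ac)
    moreover have "0 < real j / n" "real j / n < 1" using assms by auto
    ultimately show False by simp
  qed
  ultimately show ?thesis by (simp add: geometric_sum)
qed

text \<open>The relation U a t stands for q a \<le> t with a submultiplicative seminorm q; using the relation
  instead of q avoids infima when passing to quotients.\<close>

locale gauge =
  fixes U :: "'a::comm_ring_1 \<Rightarrow> real \<Rightarrow> bool"
    and sc :: "complex \<Rightarrow> 'a"
  assumes sc_add: "\<And>a b. sc (a + b) = sc a + sc b"
    and sc_mult: "\<And>a b. sc (a * b) = sc a * sc b"
    and sc_1 [simp]: "sc 1 = 1"
    and nonneg: "U a t \<Longrightarrow> 0 \<le> t"
    and add: "U a s \<Longrightarrow> U b t \<Longrightarrow> U (a + b) (s + t)"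
    and mult: "U a s \<Longrightarrow> U b t \<Longrightarrow> U (a * b) (s * t)"
    and sc: "U (sc c) (cmod c)"
    and mono: "U a s \<Longrightarrow> s \<le> t \<Longrightarrow> U a t"
    and bounded: "\<exists>t. U a t"
    and proper: "U 1 t \<Longrightarrow> 1 \<le> t"
begin

lemma sc_0 [simp]: "sc 0 = 0"
  using sc_add[of 0 0] by simp

lemma sc_minus: "sc (- a) = - sc a"
  using sc_add[of a "- a"] by (simp add: eq_neg_iff_add_eq_0 add.commute)

lemma sc_diff: "sc (a - b) = sc a - sc b"
  using sc_add[of a "- b"] sc_minus[of b] by simp

lemma sc_power: "sc (a ^ n) = sc a ^ n"
  by (induction n) (simp_all add: sc_mult)

lemma sc_sum: "sc (sum h A) = (\<Sum>i\<in>A. sc (h i))"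
  by (induction A rule: infinite_finite_induct) (simp_all add: sc_add)

lemma U_0: "U 0 0"
  using sc[of 0] by simp

lemma U_1: "U 1 1"
  using sc[of 1] by simp

lemma uminus: "U a s \<Longrightarrow> U (- a) s"
  using mult[OF sc[of "-1"], of a s] by (simp add: sc_minus)

lemma diff: "U a s \<Longrightarrow> U b t \<Longrightarrow> U (a - b) (s + t)"
  using add[OF _ uminus, of a s b t] by simp

lemma scale: "U a s \<Longrightarrow> U (sc c * a) (cmod c * s)"
  by (rule mult[OF sc])

lemma power: "U a s \<Longrightarrow> U (a ^ n) (s ^ n)"
  by (induction n) (auto intro: U_1 mult)

lemma sum: "(\<And>i. i \<in> A \<Longrightarrow> U (h i) (b i)) \<Longrightarrow> U (sum h A) (sum b A)"
  by (induction A rule: infinite_finite_induct) (auto intro: U_0 add)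

section \<open>Approximate inverses by Neumann series\<close>

lemma geometric:
  assumes w: "U w t" and t: "t < 1"
  shows "U (\<Sum>j<k. w ^ j) (1 / (1 - t))"
proof (rule mono)
  show "U (\<Sum>j<k. w ^ j) (\<Sum>j<k. t ^ j)"
    by (rule sum) (rule power[OF w])
  have t0: "0 \<le> t" by (rule nonneg[OF w])
  show "(\<Sum>j<k. t ^ j) \<le> 1 / (1 - t)"
    using t t0 by (simp add: sum_gp_strict divide_right_mono)
qed

text \<open>Truncated Neumann series: the factor \<open>\<Sum>j<k. w' ^ j\<close> replaces the
  defect \<open>w'\<close> by \<open>w' ^ k\<close>, while the size stays under the full geometric
  series. Hence the bound on \<open>y\<close> does not depend on the precision
  \<open>e\<close>.\<close>

lemma improve_inverse:
  assumes x: "U x C" and w: "U (1 - a * x) t" and t: "t < 1" and e: "0 < e"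
  obtains y where "U y (C / (1 - t))" "U (1 - a * y) e"
proof -
  define w' where "w' = 1 - a * x"
  have t0: "0 \<le> t" by (rule nonneg[OF w])
  obtain k where k: "t ^ k < e"
    using real_arch_pow_inv[OF e t] by blast
  let ?y = "x * (\<Sum>j<k. w' ^ j)"
  have "a * ?y = (1 - w') * (\<Sum>j<k. w' ^ j)"
    by (simp add: w'_def algebra_simps)
  then have "1 - a * ?y = w' ^ k"
    by (simp add: one_diff_power_eq[symmetric])
  moreover have "U (w' ^ k) (t ^ k)"
    using w by (intro power) (simp add: w'_def)
  ultimately have "U (1 - a * ?y) e"
    using k by (auto intro: mono)
  moreover have "U ?y (C / (1 - t))"
    using mult[OF x geometric[of w' t k]] w t by (simp add: w'_def)
  ultimately show ?thesis by (rule that[rotated])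
qed

text \<open>Compactness of the closed unit disc. A defect below 1 at \<open>u\<close> stays below 1
  near \<open>u\<close>, where the Neumann series yields one bound for every precision; a finite
  subcover gives \<open>C\<close>.\<close>

lemma inverse_uniform:
  assumes inv: "\<And>u. cmod u \<le> 1 \<Longrightarrow> \<exists>x t. t < 1 \<and> U (1 - (1 - sc u * f) * x) t"
  obtains C where "0 < C" "\<And>u e. cmod u \<le> 1 \<Longrightarrow> 0 < e \<Longrightarrow> \<exists>x. U x C \<and> U (1 - (1 - sc u * f) * x) e"
proof -
  have loc: "\<exists>d C. 0 < d \<and> (\<forall>v. dist v u < d \<longrightarrow> (\<forall>e>0. \<exists>x. U x C \<and> U (1 - (1 - sc v * f) * x) e))"
    if u: "cmod u \<le> 1" for u
  proof -
    obtain x t where t: "t < 1" and xt: "U (1 - (1 - sc u * f) * x) t"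
      using inv[OF u] by blast
    obtain X where X: "U x X" using bounded by blast
    obtain F where F: "U (f * x) F" using bounded by blast
    have F0: "0 \<le> F" by (rule nonneg[OF F])
    \<comment> \<open>Moving \<open>u\<close> by less than \<open>d\<close> uses up at most half of
      the gap \<open>1 - t\<close>, so the defect stays at most \<open>(1 + t) / 2\<close>.\<close>
    define d where "d = (1 - t) / (2 * (F + 1))"
    have d: "0 < d" using t F0 by (simp add: d_def)
    have dF: "d * F \<le> (1 - t) / 2"
      using t F0 unfolding d_def by (simp add: field_simps)
    have "\<exists>y. U y (X / (1 - (1 + t) / 2)) \<and> U (1 - (1 - sc v * f) * y) e"
      if v: "dist v u < d" and e: "0 < e" for v e
    proof -
      have "1 - (1 - sc v * f) * x = (1 - (1 - sc u * f) * x) + sc (v - u) * (f * x)"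
        by (simp add: sc_diff algebra_simps)
      moreover have "U \<dots> (t + cmod (v - u) * F)"
        by (intro add xt scale F)
      moreover have "cmod (v - u) * F \<le> d * F"
        using v F0 by (intro mult_right_mono) (auto simp: dist_norm)
      ultimately have "U (1 - (1 - sc v * f) * x) ((1 + t) / 2)"
        using dF by (auto elim!: mono simp: field_simps)
      from improve_inverse[OF X this _ e] t show ?thesis
        by (metis (no_types, opaque_lifting) field_sum_of_halves add.commute add_strict_right_mono mult_2 divide_less_eq_1_pos zero_less_numeral one_add_one)
    qed
    then show ?thesis using d by blast
  qed
  then obtain d C where d: "\<And>u. cmod u \<le> 1 \<Longrightarrow> 0 < d u"
    and C: "\<And>u v e. cmod u \<le> 1 \<Longrightarrow> dist v u < d u \<Longrightarrow> 0 < e \<Longrightarrow> \<exists>x. U x (C u) \<and> U (1 - (1 - sc v * f) * x) e"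
    by metis
  have "compact (cball (0::complex) 1)" by simp
  moreover have "cball (0::complex) 1 \<subseteq> (\<Union>u\<in>cball 0 1. ball u (d u))"
    using d by force
  ultimately obtain T where T: "T \<subseteq> cball 0 1" "finite T" "cball (0::complex) 1 \<subseteq> (\<Union>u\<in>T. ball u (d u))"
    by (metis (no_types, lifting) compactE_image open_ball)
  define D where "D = Max (insert 1 (C ` T))"
  have D: "C u \<le> D" if "u \<in> T" for u
    using that T(2) by (auto simp: D_def)
  have D1: "1 \<le> D" using T(2) by (auto simp: D_def)
  show ?thesis
  proof (rule that[of D])
    show "0 < D" using D1 by linarith
    fix v e assume v: "cmod v \<le> 1" and e: "(0::real) < e"
    then obtain u where u: "u \<in> T" "dist v u < d u"
      using T(3) by (force simp: dist_commute)
    then obtain x where "U x (C u)" "U (1 - (1 - sc v * f) * x) e"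
      using C[of u v e] subsetD[OF T(1) u(1)] e by auto
    then show "\<exists>x. U x D \<and> U (1 - (1 - sc v * f) * x) e"
      using D[OF u(1)] mono by blast
  qed
qed

section \<open>Small powers and the spectral radius\<close>

lemma eventually_small:
  assumes U: "\<And>n. n0 \<le> n \<Longrightarrow> U (g ^ n) (1/2)" and e: "0 < e"
  shows "\<exists>m. \<forall>n\<ge>m. U (g ^ n) e"
proof -
  \<comment> \<open>\<open>g ^ n\<close> is split into \<open>Suc k\<close> factors, all equal to
    \<open>g ^ n0\<close> except the last, whose exponent may be any number from \<open>n0\<close>
    on; each costs 1/2.\<close>
  have *: "U (g ^ n) ((1/2) ^ Suc k)" if "Suc k * n0 \<le> n" for k n
    using that
  proof (induction k arbitrary: n)
    case 0
    then show ?case using U by simp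
  next
    case (Suc k)
    have "U (g ^ n0 * g ^ (n - n0)) (1/2 * (1/2) ^ Suc k)"
      using Suc.prems by (intro mult U Suc.IH) auto
    moreover have "n0 + (n - n0) = n" using Suc.prems by auto
    ultimately show ?case by (simp flip: power_add)
  qed
  obtain k where "(1/2::real) ^ k < e"
    using real_arch_pow_inv[OF e, of "1/2"] by auto
  then have "(1/2::real) ^ Suc k \<le> e" using e by (simp add: less_imp_le)
  then show ?thesis using * mono by blast
qed

text \<open>\<open>X\<close> nearly inverts \<open>1 - v\<close> and is close to 1, so
  \<open>v\<close> must be small. The identity \<open>v = (r' - y') + v * y'\<close> improves a
  bound V of \<open>v\<close> to 5/16 + V/4; this contraction has fixed point 5/12, so finitely many
  rounds bring any initial bound below 1/2.\<close>

lemma small_from_average: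
  assumes r: "U (1 - X * (1 - v)) (1/16)" and y: "U (1 - X) (1/4)"
  shows "U v (1/2)"
proof -
  define r' y' where "r' = 1 - X * (1 - v)" and "y' = 1 - X"
  have eq: "v = (r' - y') + v * y'"
    by (simp add: r'_def y'_def algebra_simps)
  obtain V where V: "U v V" using bounded by blast
  have *: "U v (5/12 + V / 4 ^ k)" for k
  proof (induction k)
    case 0
    then show ?case using V by (auto elim: mono)
  next
    case (Suc k)
    have "U ((r' - y') + v * y') ((1/16 + 1/4) + (5/12 + V / 4 ^ k) * (1/4))"
      using r y by (intro add mult diff Suc) (simp_all add: r'_def y'_def)
    also have "(1/16 + 1/4) + (5/12 + V / 4 ^ k) * (1/4) = 5/12 + V / 4 ^ Suc k"
      by (simp add: field_simps)
    finally show ?case by (subst eq)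
  qed
  have "0 < 1 / (12 * (V + 1))" using nonneg[OF V] by simp
  then obtain k where k: "(1/4::real) ^ k < 1 / (12 * (V + 1))"
    using real_arch_pow_inv[of "1 / (12 * (V + 1))" "1/4"] by (auto simp del: times_divide_eq_right)
  then have "V / 4 ^ k \<le> V * (1 / (12 * (V + 1)))"
    using nonneg[OF V] mult_left_mono[of "(1/4) ^ k" "1 / (12 * (V + 1))" V]
    by (simp add: power_one_over field_simps)
  also have "\<dots> \<le> 1/12" using nonneg[OF V] by (simp add: field_simps)
  finally show ?thesis by (intro mono[OF *[of k]]) linarith
qed

text \<open>Only the terms \<open>j = 0\<close> survive the sum over the roots of unity. Since
  \<open>1 - a\<close> times \<open>\<Sum>j<n. a ^ j\<close> is \<open>1 - a ^ n\<close>, this makes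
  averaged inverses of 1 - t w f invert 1 - (t f)^n.\<close>

lemma average_identity:
  fixes f :: 'a and t :: real and n :: nat
  assumes n: "0 < n"
  shows "(\<Sum>i<n. \<Sum>j<n. (sc (t * cis (2 * pi * real i / real n)) * f) ^ j) = sc (of_nat n)"
proof -
  have "(\<Sum>i<n. \<Sum>j<n. (sc (t * cis (2 * pi * real i / real n)) * f) ^ j)
      = (\<Sum>j<n. sc (t ^ j * (\<Sum>i<n. (cis (2 * pi * real i / real n)) ^ j)) * f ^ j)"
    by (subst sum.swap)
      (simp add: power_mult_distrib sc_power sc_mult sc_sum sum_distrib_left sum_distrib_right mult_ac)
  also have "\<dots> = (\<Sum>j<n. if j = 0 then sc (of_nat n) else 0)"
    using n by (intro sum.cong) (auto simp: roots_of_unity_sum)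
  finally show ?thesis using n by (simp add: sum.delta')
qed

text \<open>The gauge form of "spectral radius below 1".\<close>

definition small_powers :: "'a \<Rightarrow> bool" where
  "small_powers g \<longleftrightarrow> (\<forall>e>0. \<exists>m. \<forall>n\<ge>m. U (g ^ n) e)"

text \<open>Averaging approximate inverses of 1 - t w f over the n-th roots of unity w gives an approximate
  inverse of 1 - (t f)^n, and this average depends on t with a modulus of continuity that is
  independent of n.\<close>

lemma small_powers_step:
  fixes t t' d :: real
  assumes C: "0 < C" "\<And>u e. cmod u \<le> 1 \<Longrightarrow> 0 < e \<Longrightarrow> \<exists>x. U x C \<and> U (1 - (1 - sc u * f) * x) e"
    and F: "U f F" and d: "C * C * F * d \<le> 1/8"
    and t: "0 \<le> t" "t \<le> t'" "t' \<le> 1" "t' - t \<le> d"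
    and small: "small_powers (sc t * f)"
  shows "small_powers (sc t' * f)"
proof -
  \<comment> \<open>The budget is 1/4 for \<open>1 - X t'\<close>, as
    \<open>small_from_average\<close> asks: \<open>1 - X t\<close> takes 1/32 for its defect and
    1/32 for \<open>X t * (sc t * f) ^ n\<close>, whence \<open>32 * C\<close>, and
    \<open>X t' - X t\<close> takes 1/16 + 1/8.\<close>
  have "0 < 1 / (32 * C)" using C by simp
  then obtain m where m: "\<And>n. m \<le> n \<Longrightarrow> U ((sc t * f) ^ n) (1 / (32 * C))"
    using small unfolding small_powers_def by blast
  have "U ((sc t' * f) ^ n) (1/2)" if n: "max 1 m \<le> n" for n
  proof -
    define w where "w i = cis (2 * pi * real i / real n)" for i
    have n0: "0 < n" and mn: "m \<le> n" using n by auto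
    have wn: "w i ^ n = 1" for i
      using n0 by (simp add: w_def Complex.DeMoivre cis_multiple_2pi)
    define Q where "Q s i = (\<Sum>j<n. (sc (of_real s * w i) * f) ^ j)" for s :: real and i
    obtain B where B: "1 \<le> B" "\<And>s i. 0 \<le> s \<Longrightarrow> s \<le> 1 \<Longrightarrow> U (Q s i) B"
    proof
      let ?B = "\<Sum>j<n. max 1 F ^ j"
      show "1 \<le> max 1 ?B" by simp
      show "U (Q s i) (max 1 ?B)" if "0 \<le> s" "s \<le> 1" for s i
      proof (rule mono)
        show "U (Q s i) ?B"
          unfolding Q_def
        proof (intro sum power)
          have "U (sc (of_real s * w i) * f) (cmod (of_real s * w i) * F)"
            by (rule scale[OF F])
          moreover have "cmod (of_real s * w i) * F \<le> 1 * F"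
            using that nonneg[OF F] by (intro mult_right_mono) (auto simp: w_def norm_mult)
          ultimately show "U (sc (of_real s * w i) * f) (max 1 F)"
            by (auto elim!: mono)
        qed
      qed simp
    qed
    \<comment> \<open>\<open>B\<close> may grow with \<open>n\<close>. This is harmless:
      \<open>e\<close> may depend on \<open>n\<close> because \<open>C\<close> serves every
      precision.\<close>
    define e where "e = min (1 / (32 * B)) (1 / (32 * C))"
    have e: "0 < e" "e * B \<le> 1/32" "e * C \<le> 1/32"
      using B(1) C(1) by (auto simp: e_def min_def field_simps)
    have "\<forall>s i. 0 \<le> s \<and> s \<le> 1 \<longrightarrow> (\<exists>x. U x C \<and> U (1 - (1 - sc (complex_of_real s * w i) * f) * x) e)"
      by (intro allI impI C(2) e) (auto simp: w_def norm_mult)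
    then obtain x where x: "\<And>s i. 0 \<le> s \<Longrightarrow> s \<le> 1 \<Longrightarrow> U (x s i) C"
      and xi: "\<And>s i. 0 \<le> s \<Longrightarrow> s \<le> 1 \<Longrightarrow> U (1 - (1 - sc (complex_of_real s * w i) * f) * x s i) e"
      by metis
    define X where "X s = sc (1 / of_nat n) * (\<Sum>i<n. x s i)" for s
    have avg: "U (sc (1 / of_nat n) * (\<Sum>i<n. h i)) b" if "\<And>i. U (h i) b" for h b
    proof -
      have "U (sc (1 / of_nat n) * (\<Sum>i<n. h i)) (cmod (1 / of_nat n) * (\<Sum>i<n. b))"
        by (intro scale sum that)
      then show ?thesis using n0 by (simp add: norm_divide)
    qed
    have X1: "U (1 - X s * (1 - (sc s * f) ^ n)) (1/32)" if s: "0 \<le> s" "s \<le> 1" for s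
    proof -
      have Qi: "(1 - sc (of_real s * w i) * f) * Q s i = 1 - (sc s * f) ^ n" for i
      proof -
        have "sc (w i) ^ n = 1" by (simp add: wn flip: sc_power)
        then have "(sc (of_real s * w i) * f) ^ n = (sc s * f) ^ n"
          by (simp add: sc_mult power_mult_distrib)
        then show ?thesis unfolding Q_def by (simp flip: one_diff_power_eq)
      qed
      have "1 = sc (1 / of_nat n) * (\<Sum>i<n. Q s i)"
        using average_identity[OF n0, where f = f and t = s] n0 unfolding Q_def w_def
        by (simp flip: sc_mult)
      moreover have "X s * (1 - (sc s * f) ^ n) = sc (1 / of_nat n) * (\<Sum>i<n. x s i * (1 - sc (of_real s * w i) * f) * Q s i)"
        unfolding X_def by (simp add: sum_distrib_right mult.assoc Qi)
      ultimately have "1 - X s * (1 - (sc s * f) ^ n)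
          = sc (1 / of_nat n) * (\<Sum>i<n. (1 - (1 - sc (of_real s * w i) * f) * x s i) * Q s i)"
      proof -
        have "(1 - (1 - sc (of_real s * w i) * f) * x s i) * Q s i
            = Q s i - x s i * (1 - sc (of_real s * w i) * f) * Q s i" for i
          by (simp add: algebra_simps)
        then show ?thesis
          using \<open>1 = _\<close> \<open>X s * _ = _\<close> by (simp only: sum_subtractf right_diff_distrib)
      qed
      moreover have "U \<dots> (e * B)"
        by (intro avg mult xi B s)
      ultimately show ?thesis using e by (auto elim!: mono)
    qed
    have t1: "t \<le> 1" and t'0: "0 \<le> t'" using t by auto
    have XC: "U (X t) C" unfolding X_def using t t1 by (intro avg x) auto
    have "U (X t' - X t) (1/16 + 1/8)"
    proof -
      have "U (x t' i - x t i) (1/16 + 1/8)" for i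
      proof -
        let ?a = "1 - sc (of_real t' * w i) * f" and ?b = "1 - sc (of_real t * w i) * f"
        \<comment> \<open>The resolvent identity, corrected by the defects of the two approximate
          inverses.\<close>
        have "x t' i - x t i = (x t' i * (1 - ?b * x t i) - x t i * (1 - ?a * x t' i)) + x t' i * x t i * (sc (of_real (t' - t) * w i) * f)"
          by (simp add: sc_mult sc_diff algebra_simps)
        moreover have "U \<dots> ((C * e + C * e) + C * C * (cmod (of_real (t' - t) * w i) * F))"
          using t t1 t'0 by (intro add diff mult x xi scale F) auto
        moreover have "C * C * (cmod (of_real (t' - t) * w i) * F) \<le> C * C * (d * F)"
          using t nonneg[OF F] C(1)
          by (intro mult_left_mono mult_right_mono) (auto simp: norm_mult w_def simp del: of_real_diff)
        ultimately show ?thesis using e d by (auto elim!: mono simp: mult_ac)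
      qed
      then have "U (sc (1 / of_nat n) * (\<Sum>i<n. x t' i - x t i)) (1/16 + 1/8)"
        by (rule avg)
      then show ?thesis by (simp add: X_def sum_subtractf right_diff_distrib)
    qed
    moreover have "U (1 - X t) (1/32 + C * (1 / (32 * C)))"
    proof -
      have "1 - X t = (1 - X t * (1 - (sc t * f) ^ n)) - X t * (sc t * f) ^ n"
        by (simp add: algebra_simps)
      then show ?thesis
        using diff[OF X1[OF t(1) t1] mult[OF XC m[OF mn]]] by metis
    qed
    ultimately have "U ((1 - X t) - (X t' - X t)) ((1/32 + C * (1 / (32 * C))) + (1/16 + 1/8))"
      by (rule diff[rotated])
    moreover have c: "C * (1 / (32 * C)) = 1/32" using C by simp
    ultimately have "U (1 - X t') (1/4)" unfolding c by simp
    moreover have "U (1 - X t' * (1 - (sc t' * f) ^ n)) (1/16)"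
      using X1[of t'] t t'0 by (auto elim: mono)
    ultimately show ?thesis by (rule small_from_average[rotated])
  qed
  then show ?thesis unfolding small_powers_def
    by (blast intro: eventually_small)
qed

text \<open>Continuation in t from 0, where the powers vanish, to 1. The step length
  \<open>1 / M\<close> is admissible everywhere because it is governed by \<open>C\<close> and
  \<open>F\<close> alone, not by the point already reached.\<close>

lemma small_powers_if_invertible:
  assumes inv: "\<And>u. cmod u \<le> 1 \<Longrightarrow> \<exists>x t. t < 1 \<and> U (1 - (1 - sc u * f) * x) t"
  shows "small_powers f"
proof -
  obtain C where C: "0 < C" "\<And>u e. cmod u \<le> 1 \<Longrightarrow> 0 < e \<Longrightarrow> \<exists>x. U x C \<and> U (1 - (1 - sc u * f) * x) e"
    using inverse_uniform[OF inv] by blast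
  obtain F where F: "U f F" using bounded by blast
  define M where "M = nat \<lceil>8 * (C * C * F)\<rceil> + 1"
  have M: "8 * (C * C * F) \<le> real M" "0 < M"
    unfolding M_def by (auto simp: of_nat_ceiling intro: order_trans[OF of_nat_ceiling])
  have "small_powers (sc (real k / real M) * f)" if "k \<le> M" for k
    using that
  proof (induction k)
    case 0
    have "U ((sc (real 0 / real M) * f) ^ n) e" if "1 \<le> n" "0 < e" for n e
      using that mono[OF U_0, of e] by (simp add: power_0_left)
    then show ?case unfolding small_powers_def by blast
  next
    case (Suc k)
    show ?case
    proof (rule small_powers_step[OF C F, where t = "real k / real M" and d = "1 / real M"])
      show "C * C * F * (1 / real M) \<le> 1/8" using M by (simp add: field_simps)
      show "real k / real M \<le> real (Suc k) / real M" "real (Suc k) / real M \<le> 1"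
        using Suc.prems M by (auto simp: divide_right_mono)
      show "real (Suc k) / real M - real k / real M \<le> 1 / real M"
        by (simp flip: diff_divide_distrib)
      show "small_powers (sc (complex_of_real (real k / real M)) * f)"
        using Suc by simp
    qed auto
  qed
  from this[of M] show ?thesis using M by simp
qed

text \<open>Gelfand-Mazur argument. If every \<open>z - sc \<alpha>\<close> were approximately
  invertible, all multiples of \<open>z\<close> would have small powers. But \<open>z\<close> has an
  approximate inverse \<open>y\<close>, so \<open>(z * y) ^ n\<close> is the product of the n-th
  powers of T z and y / T; it is tiny for large T, and yet \<open>S ^ n\<close> turns it into almost
  1. This contradicts \<open>proper\<close>.\<close>

lemma spectrum_nonempty:
  "\<exists>\<alpha>. \<forall>x t. U (1 - (z - sc \<alpha>) * x) t \<longrightarrow> 1 \<le> t"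
proof (rule ccontr)
  assume "\<not> ?thesis"
  then have inv: "\<exists>x t. t < 1 \<and> U (1 - (z - sc \<alpha>) * x) t" for \<alpha>
    by (meson not_le)
  have small: "small_powers (sc T * z)" if T: "T \<noteq> 0" for T
  proof (rule small_powers_if_invertible)
    fix u :: complex
    show "\<exists>x t. t < 1 \<and> U (1 - (1 - sc u * (sc T * z)) * x) t"
    proof (cases "u = 0")
      case True
      then have "U (1 - (1 - sc u * (sc T * z)) * 1) 0" using U_0 by simp
      then show ?thesis by (meson zero_less_one)
    next
      case False
      \<comment> \<open>1 - u T z is - u T times z - 1 / (u T), which dictates the spectral
        value.\<close>
      obtain x t where x: "t < 1" "U (1 - (z - sc (1 / (u * T))) * x) t"
        using inv by blast
      have "(1 - sc u * (sc T * z)) * (sc (- 1 / (u * T)) * x)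
          = (sc (- 1 / (u * T)) - sc (u * T * (- 1 / (u * T))) * z) * x"
        unfolding sc_mult[of "u * T"] sc_mult[of u T] by (simp add: algebra_simps)
      also have "u * T * (- 1 / (u * T)) = - 1" using False T by simp
      also have "(sc (- 1 / (u * T)) - sc (- 1) * z) * x = (z - sc (1 / (u * T))) * x"
        by (simp add: sc_minus)
      finally show ?thesis using x by metis
    qed
  qed
  obtain x t X where x: "t < 1" "U (1 - z * x) t" "U x X"
    using inv[of 0] bounded by (metis diff_zero sc_0)
  then obtain y where y: "U y (X / (1 - t))" "U (1 - z * y) (1/4)"
    using improve_inverse[of x X z t "1/4"] by auto
  define Y where "Y = X / (1 - t)"
  \<comment> \<open>Now y / T has size at most 1/2, so together with the bound 4/3 for
    \<open>S\<close> each of the n factors contributes less than 1.\<close>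
  define T where "T = 2 * Y + 1"
  have T: "0 < T" "Y \<le> T / 2"
    using nonneg[OF y(1)] by (auto simp: T_def Y_def[symmetric])
  define w where "w = 1 - z * y"
  have w: "U w (1/4)" using y by (simp add: w_def)
  obtain n where n: "U ((sc T * z) ^ n) (1/4)"
  proof -
    have "\<exists>m. \<forall>n\<ge>m. U ((sc T * z) ^ n) (1/4)"
      using small[of T] T unfolding small_powers_def by simp
    then show ?thesis using that by blast
  qed
  have "(1 - w) ^ n = (sc T * z) ^ n * (sc (1 / T) * y) ^ n"
  proof -
    have "(sc T * z) * (sc (1 / T) * y) = (sc T * sc (1 / T)) * (z * y)"
      by (simp only: mult_ac)
    also have "sc T * sc (1 / T) = 1" using T by (simp flip: sc_mult)
    finally have "(sc T * z) * (sc (1 / T) * y) = z * y" by simp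
    then show ?thesis by (simp add: w_def flip: power_mult_distrib)
  qed
  moreover have "U (sc (1 / T) * y) (1/2)"
    using scale[OF y(1)[folded Y_def], of "1 / T"] T by (auto elim!: mono simp: norm_divide field_simps)
  ultimately have v: "U ((1 - w) ^ n) (1/4 * (1/2) ^ n)"
    using mult[OF n power] by auto
  \<comment> \<open>\<open>k\<close> is chosen after \<open>n\<close>, because
    \<open>1 - (1 - w ^ k) ^ n\<close> costs \<open>(1/4) ^ k\<close> times a sum of
    \<open>n\<close> powers of 2.\<close>
  have "0 < 1 / (4 * (real n + 1) * 2 ^ n)" by simp
  then obtain k where k: "(1/4::real) ^ k < 1 / (4 * (real n + 1) * 2 ^ n)"
    by (rule exE[OF real_arch_pow_inv]) auto
  define S where "S = (\<Sum>j<k. w ^ j)"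
  have "U S (4/3)" using geometric[OF w, of k] by (simp add: S_def)
  then have "U (S ^ n * (1 - w) ^ n) ((4/3) ^ n * (1/4 * (1/2) ^ n))"
    by (intro mult power v)
  moreover have "S ^ n * (1 - w) ^ n = (1 - w ^ k) ^ n"
    by (simp add: S_def one_diff_power_eq mult.commute flip: power_mult_distrib)
  moreover have "(4/3::real) ^ n * (1/4 * (1/2) ^ n) \<le> 1/4"
    by (simp add: power_le_one flip: power_mult_distrib)
  ultimately have 1: "U ((1 - w ^ k) ^ n) (1/4)" by (auto elim: mono)
  have "U (1 - (1 - w ^ k) ^ n) ((1/4) ^ k * (\<Sum>j<n. 2 ^ j))"
  proof -
    have "1 - (1 - w ^ k) ^ n = w ^ k * (\<Sum>j<n. (1 - w ^ k) ^ j)"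
      using one_diff_power_eq[of "1 - w ^ k" n] by simp
    moreover have "U (1 - w ^ k) 2"
    proof (rule mono)
      show "U (1 - w ^ k) (1 + (1/4) ^ k)" by (intro diff U_1 power w)
    qed (simp add: power_le_one)
    ultimately show ?thesis by (auto intro!: mult power w sum)
  qed
  moreover have "(1/4::real) ^ k * (\<Sum>j<n. 2 ^ j) \<le> 1/4"
  proof -
    have "(\<Sum>j<n. 2 ^ j) \<le> (\<Sum>j<n. (2::real) ^ n)"
      by (intro sum_mono power_increasing) auto
    then have "(\<Sum>j<n. 2 ^ j) \<le> (real n + 1) * 2 ^ n" by (simp add: distrib_right add_increasing2)
    then have "(1/4::real) ^ k * (\<Sum>j<n. 2 ^ j) \<le> 1 / (4 * (real n + 1) * 2 ^ n) * ((real n + 1) * 2 ^ n)"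
      using k by (intro mult_mono) (auto intro: sum_nonneg)
    also have "\<dots> = 1/4"
      using add_pos_pos[of "real n + 1" 1] by (simp add: divide_simps)
    finally show ?thesis .
  qed
  ultimately have "U (1 - (1 - w ^ k) ^ n) (1/4)" by (auto elim: mono)
  from add[OF this 1] have "U 1 (1/4 + 1/4)" by simp
  then show False using proper by fastforce
qed

end

text \<open>\<open>quot\<close> keeps the ideal of \<open>g\<close> away from 1, so the quotient
  does not collapse. The other laws pass to residues by picking a representative of each.\<close>

lemma gauge_quotient:
  assumes U: "gauge U sc" and quot: "\<And>x t. U (1 - g * x) t \<Longrightarrow> 1 \<le> t"
  shows "gauge (\<lambda>p t. \<exists>x. U (p - g * x) t) sc"
proof -
  interpret gauge U sc by fact
  have U0: "\<exists>x. U (p - g * x) t" if "U p t" for p t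
    using that by (intro exI[of _ 0]) simp
  show ?thesis
  proof
    fix a b s t
    assume "\<exists>x. U (a - g * x) s" "\<exists>x. U (b - g * x) t"
    then obtain x y where xy: "U (a - g * x) s" "U (b - g * y) t" by blast
    have "U (a + b - g * (x + y)) (s + t)"
      using add[OF xy] by (simp add: algebra_simps)
    then show "\<exists>x. U (a + b - g * x) (s + t)" by blast
    have "U (a * b - g * (a * y + b * x - g * x * y)) (s * t)"
      using mult[OF xy] by (simp add: algebra_simps)
    then show "\<exists>x. U (a * b - g * x) (s * t)" by blast
  next
    show "\<exists>x. U (sc c - g * x) (cmod c)" for c by (rule U0[OF sc])
    show "\<exists>t x. U (a - g * x) t" for a using bounded U0 by blast
    show "sc (a + b) = sc a + sc b" "sc (a * b) = sc a * sc b" for a b by (rule sc_add sc_mult)+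
    show "sc 1 = 1" by (rule sc_1)
    show "0 \<le> t" if "\<exists>x. U (a - g * x) t" for a t using that nonneg by blast
    show "\<exists>x. U (a - g * x) t" if "\<exists>x. U (a - g * x) s" "s \<le> t" for a s t using that mono by blast
    show "1 \<le> t" if "\<exists>x. U (1 - g * x) t" for t using that quot by blast
  qed
qed

section \<open>Polynomials in two variables and their characters\<close>

text \<open>Polynomials are elements of \<open>complex poly poly\<close>, not functions satisfying
  \<open>hpoly2\<close>, because \<open>gauge\<close> lives on a commutative ring type and division
  with remainder is available there. The outer variable is the second coordinate.\<close>

definition const :: "complex \<Rightarrow> complex poly poly" where "const c = [:[:c:]:]"
definition X1 :: "complex poly poly" where "X1 = [:[:0, 1:]:]"
definition X2 :: "complex poly poly" where "X2 = [:0, 1:]"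

definition ev :: "complex poly poly \<Rightarrow> complex \<times> complex \<Rightarrow> complex" where
  "ev p z = poly (poly p [:snd z:]) (fst z)"

lemma ev_simps [simp]:
  "ev 0 z = 0" "ev 1 z = 1" "ev (const c) z = c" "ev X1 z = fst z" "ev X2 z = snd z"
  "ev (p + q) z = ev p z + ev q z" "ev (p - q) z = ev p z - ev q z" "ev (- p) z = - ev p z"
  "ev (p * q) z = ev p z * ev q z" "ev (p ^ n) z = ev p z ^ n"
  by (simp_all add: ev_def const_def X1_def X2_def)

lemma ev_sum [simp]: "ev (sum h A) z = (\<Sum>i\<in>A. ev (h i) z)"
  by (simp add: ev_def poly_sum)

lemma continuous_on_ev [continuous_intros]:
  assumes "continuous_on S h"
  shows "continuous_on S (\<lambda>x. ev p (h x))"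
proof -
  have "continuous_on S (\<lambda>x. ev p (h x))"
  proof (induction p)
    case 0
    then show ?case by simp
  next
    case (pCons a p)
    have "ev (pCons a p) z = poly a (fst z) + snd z * ev p z" for z
      by (simp add: ev_def)
    then show ?case using pCons assms by (auto intro!: continuous_intros)
  qed
  then show ?thesis .
qed

lemma poly_eq_sum:
  fixes p :: "'a::comm_semiring_1 poly"
  assumes "degree p \<le> n"
  shows "poly p x = (\<Sum>i\<le>n. coeff p i * x ^ i)"
  unfolding poly_altdef using assms
  by (intro sum.mono_neutral_left) (auto simp: coeff_eq_0)

lemma hpoly2_ev: "hpoly2 (ev p)"
proof -
  define N where "N = Max (insert (degree p) ((\<lambda>j. degree (coeff p j)) ` {..degree p}))"
  have N1: "degree p \<le> N" by (simp add: N_def)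
  have N2: "degree (coeff p j) \<le> N" for j
  proof (cases "j \<le> degree p")
    case True
    then show ?thesis unfolding N_def by (intro Max_ge) auto
  qed (simp add: coeff_eq_0)
  have "poly (poly p [:y:]) x = (\<Sum>i\<le>N. \<Sum>j\<le>N. coeff (coeff p j) i * x ^ i * y ^ j)" for x y
  proof -
    have "poly p [:y:] = (\<Sum>j\<le>N. coeff p j * [:y:] ^ j)"
      by (rule poly_eq_sum[OF N1])
    then have "poly (poly p [:y:]) x = (\<Sum>j\<le>N. poly (coeff p j) x * y ^ j)"
      by (simp add: poly_sum)
    also have "\<dots> = (\<Sum>j\<le>N. (\<Sum>i\<le>N. coeff (coeff p j) i * x ^ i) * y ^ j)"
      by (simp only: poly_eq_sum[OF N2])
    finally show ?thesis by (subst sum.swap) (simp add: sum_distrib_right)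
  qed
  then show ?thesis unfolding hpoly2_def ev_def
    by (intro exI[of _ N] exI[of _ "\<lambda>i j. coeff (coeff p j) i"]) simp
qed

lemma hpoly2E:
  assumes "hpoly2 f"
  obtains p where "f = ev p"
proof -
  obtain N and c :: "nat \<Rightarrow> nat \<Rightarrow> complex" where
    f: "\<And>z. f z = (\<Sum>i\<le>N. \<Sum>j\<le>N. c i j * fst z ^ i * snd z ^ j)"
    using assms unfolding hpoly2_def by blast
  have "f = ev (\<Sum>i\<le>N. \<Sum>j\<le>N. const (c i j) * X1 ^ i * X2 ^ j)"
    by (rule ext) (simp only: f ev_simps ev_sum)
  then show ?thesis by (rule that)
qed

section \<open>Basic properties of polynomial hulls\<close>

lemma poly_hull_iff:
  "z \<in> poly_hull K \<longleftrightarrow> (\<forall>p t. (\<forall>w\<in>K. cmod (ev p w) \<le> t) \<longrightarrow> cmod (ev p z) \<le> t)"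
  unfolding poly_hull_def by (auto intro: hpoly2_ev elim!: hpoly2E)

lemma poly_hullD:
  "z \<in> poly_hull K \<Longrightarrow> (\<And>w. w \<in> K \<Longrightarrow> cmod (ev p w) \<le> t) \<Longrightarrow> cmod (ev p z) \<le> t"
  by (auto simp: poly_hull_iff)

lemma subset_poly_hull: "K \<subseteq> poly_hull K"
  by (auto simp: poly_hull_iff)

lemma compact_poly_hull:
  assumes "compact K"
  shows "compact (poly_hull K)"
proof -
  have "poly_hull K = (\<Inter>(p, t)\<in>{(p, t). \<forall>w\<in>K. cmod (ev p w) \<le> t}. {z. cmod (ev p z) \<le> t})"
    by (auto simp: poly_hull_iff)
  moreover have "closed {z. cmod (ev p z) \<le> t}" for p t
    by (intro closed_Collect_le continuous_intros)
  ultimately have "closed (poly_hull K)" by auto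
  moreover obtain B where B: "\<And>w. w \<in> K \<Longrightarrow> norm w \<le> B"
    using compact_imp_bounded[OF assms] by (auto simp: bounded_iff)
  have "norm z \<le> B + B" if "z \<in> poly_hull K" for z
  proof -
    have "cmod (ev X1 w) \<le> B" "cmod (ev X2 w) \<le> B" if "w \<in> K" for w
      using B[OF that] norm_fst_le[of "fst w" "snd w"] norm_snd_le[of "snd w" "fst w"] by auto
    then have "cmod (ev X1 z) \<le> B" "cmod (ev X2 z) \<le> B"
      using poly_hullD[OF that] by blast+
    then show ?thesis using norm_Pair_le[of "fst z" "snd z"] by simp
  qed
  then have "bounded (poly_hull K)" unfolding bounded_iff by blast
  ultimately show ?thesis by (simp add: compact_eq_bounded_closed)
qed

text \<open>Two divisions with remainder, first by \<open>X2 - const (snd z)\<close>, then of the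
  remainder by \<open>X1 - const (fst z)\<close>: the ideal of a point is generated by these two
  linear polynomials.\<close>

lemma ev_decompose:
  obtains A B where "p = const (ev p z) + (X1 - const (fst z)) * A + (X2 - const (snd z)) * B"
proof -
  have "poly (p - [:poly p [:snd z:]:]) [:snd z:] = 0" by simp
  then obtain B where B: "p - [:poly p [:snd z:]:] = [:- [:snd z:], 1:] * B"
    unfolding poly_eq_0_iff_dvd by (auto elim: dvdE)
  define r where "r = poly p [:snd z:]"
  have "poly (r - [:poly r (fst z):]) (fst z) = 0" by simp
  then obtain A where A: "r - [:poly r (fst z):] = [:- fst z, 1:] * A"
    unfolding poly_eq_0_iff_dvd by (auto elim: dvdE)
  have "p = [:r:] + [:- [:snd z:], 1:] * B" using B unfolding r_def by (metis add.commute diff_add_cancel)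
  moreover have "[:r:] = const (ev p z) + [:[:- fst z, 1:]:] * [:A:]"
    using A by (simp add: r_def ev_def const_def algebra_simps)
  moreover have "[:- [:snd z:], 1:] = X2 - const (snd z)" by (simp add: X2_def const_def)
  moreover have "[:[:- fst z, 1:]:] = X1 - const (fst z)" by (simp add: X1_def const_def)
  ultimately show ?thesis using that by metis
qed

text \<open>Since \<open>f\<close> lacks small powers, some \<open>1 - const u * f\<close> is not
  approximately invertible, and dividing by it forces u f = 1. Dividing further by
  \<open>X1 - const \<alpha>\<close> and \<open>X2 - const \<beta>\<close>, with spectral values
  taken in the successive quotients, leaves only constants; the character is evaluation at
  \<open>(\<alpha>, \<beta>)\<close>.\<close>

lemma gauge_character:
  assumes U: "gauge U const" and f: "\<not> gauge.small_powers U f"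
  obtains z where "\<And>p t. U p t \<Longrightarrow> cmod (ev p z) \<le> t" "1 \<le> cmod (ev f z)"
proof -
  interpret gauge U const by fact
  obtain u where u: "cmod u \<le> 1" "\<And>x t. U (1 - (1 - const u * f) * x) t \<Longrightarrow> 1 \<le> t"
    using small_powers_if_invertible[of f] f not_le by metis
  define g where "g = 1 - const u * f"
  define U1 where "U1 p t \<longleftrightarrow> (\<exists>x. U (p - g * x) t)" for p t
  have "gauge U1 const"
    unfolding U1_def by (rule gauge_quotient[OF U]) (simp only: g_def u(2))
  then interpret U1: gauge U1 const .
  obtain \<alpha> where \<alpha>: "\<And>x t. U1 (1 - (X1 - const \<alpha>) * x) t \<Longrightarrow> 1 \<le> t"
    using U1.spectrum_nonempty by blast
  define U2 where "U2 p t \<longleftrightarrow> (\<exists>x. U1 (p - (X1 - const \<alpha>) * x) t)" for p t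
  have "gauge U2 const"
    unfolding U2_def by (rule gauge_quotient[OF U1.gauge_axioms \<alpha>])
  then interpret U2: gauge U2 const .
  obtain \<beta> where \<beta>: "\<And>x t. U2 (1 - (X2 - const \<beta>) * x) t \<Longrightarrow> 1 \<le> t"
    using U2.spectrum_nonempty by blast
  define U3 where "U3 p t \<longleftrightarrow> (\<exists>x. U2 (p - (X2 - const \<beta>) * x) t)" for p t
  have "gauge U3 const"
    unfolding U3_def by (rule gauge_quotient[OF U2.gauge_axioms \<beta>])
  then interpret U3: gauge U3 const .
  \<comment> \<open>In the last quotient \<open>p\<close> becomes the constant
    \<open>ev p (\<alpha>, \<beta>)\<close>, and \<open>U3.proper\<close>, applied after normalising
    this constant to 1, bounds its modulus by \<open>t\<close>.\<close>
  have ev: "cmod (ev p (\<alpha>, \<beta>)) \<le> t" if p: "U1 p t" for p t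
  proof (cases "ev p (\<alpha>, \<beta>) = 0")
    case True
    then show ?thesis using U1.nonneg[OF p] by simp
  next
    case False
    define c where "c = ev p (\<alpha>, \<beta>)"
    obtain A B where AB: "p = const c + (X1 - const \<alpha>) * A + (X2 - const \<beta>) * B"
      using ev_decompose[of p "(\<alpha>, \<beta>)"] by (auto simp: c_def)
    have "const c - (X2 - const \<beta>) * (- B) - (X1 - const \<alpha>) * (- A) = p"
      by (subst AB) (simp add: algebra_simps)
    then have "U2 (const c - (X2 - const \<beta>) * (- B)) t"
      unfolding U2_def using p by metis
    then have "U3 (const c) t"
      unfolding U3_def by blast
    from U3.scale[OF this, of "1 / c"] have "U3 1 (cmod (1 / c) * t)"
      using False by (simp add: c_def flip: U3.sc_mult)
    then have "1 \<le> cmod (1 / c) * t" by (rule U3.proper)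
    then show ?thesis using False by (simp add: c_def norm_divide field_simps)
  qed
  have "U1 g 0"
    unfolding U1_def using U_0 by (intro exI[of _ 1]) simp
  from ev[OF this] have uf: "u * ev f (\<alpha>, \<beta>) = 1" by (simp add: g_def)
  have "1 = cmod u * cmod (ev f (\<alpha>, \<beta>))" using uf by (metis norm_mult norm_one)
  also have "\<dots> \<le> 1 * cmod (ev f (\<alpha>, \<beta>))" using u(1) by (intro mult_right_mono) auto
  finally have "1 \<le> cmod (ev f (\<alpha>, \<beta>))" by simp
  moreover have "U1 p t" if "U p t" for p t
    unfolding U1_def using that by (intro exI[of _ 0]) simp
  ultimately show ?thesis using that ev by blast
qed

section \<open>The maximum principle over a disc\<close>

text \<open>The quotient seminorm modulo h on K that also controls the cofactor a on S; it is
  submultiplicative because G bounds h on S.\<close>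

definition residue_gauge ::
    "(complex \<times> complex) set \<Rightarrow> (complex \<times> complex) set \<Rightarrow> real \<Rightarrow> complex poly poly \<Rightarrow> complex poly poly \<Rightarrow> real \<Rightarrow> bool" where
  "residue_gauge K S G h p t \<longleftrightarrow> (\<exists>a u v. 0 \<le> u \<and> 0 \<le> v \<and> u + G * v \<le> t \<and>
     (\<forall>w\<in>K. cmod (ev (p - h * a) w) \<le> u) \<and> (\<forall>w\<in>S. cmod (ev a w) \<le> v))"

lemma residue_gaugeI:
  "\<lbrakk>0 \<le> u; 0 \<le> v; u + G * v \<le> t; \<And>w. w \<in> K \<Longrightarrow> cmod (ev (p - h * a) w) \<le> u;
    \<And>w. w \<in> S \<Longrightarrow> cmod (ev a w) \<le> v\<rbrakk> \<Longrightarrow> residue_gauge K S G h p t"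
  unfolding residue_gauge_def by blast

lemma residue_gaugeE:
  assumes "residue_gauge K S G h p t"
  obtains a u v where "0 \<le> u" "0 \<le> v" "u + G * v \<le> t"
    "\<And>w. w \<in> K \<Longrightarrow> cmod (ev (p - h * a) w) \<le> u" "\<And>w. w \<in> S \<Longrightarrow> cmod (ev a w) \<le> v"
  using assms unfolding residue_gauge_def by blast

lemma ev_bounded:
  assumes "compact K"
  obtains B where "0 \<le> B" "\<And>w. w \<in> K \<Longrightarrow> cmod (ev p w) \<le> B"
proof -
  have "compact ((\<lambda>w. ev p w) ` K)"
    by (intro compact_continuous_image continuous_intros assms)
  from compact_imp_bounded[OF this] obtain B where "\<forall>x\<in>(\<lambda>w. ev p w) ` K. cmod x \<le> B"
    unfolding bounded_iff by blast
  then have "\<And>w. w \<in> K \<Longrightarrow> cmod (ev p w) \<le> max 0 B" by fastforce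
  then show ?thesis using that[of "max 0 B"] by simp
qed

lemma residue_gauge_mult:
  assumes "S \<subseteq> K" and G: "0 \<le> G" "\<And>w. w \<in> S \<Longrightarrow> cmod (ev h w) \<le> G"
    and "residue_gauge K S G h p s" "residue_gauge K S G h q t"
  shows "residue_gauge K S G h (p * q) (s * t)"
proof -
  obtain a u v where a: "0 \<le> u" "0 \<le> v" "u + G * v \<le> s"
    "\<And>w. w \<in> K \<Longrightarrow> cmod (ev (p - h * a) w) \<le> u" "\<And>w. w \<in> S \<Longrightarrow> cmod (ev a w) \<le> v"
    using assms(4) by (rule residue_gaugeE) blast
  obtain a' u' v' where a': "0 \<le> u'" "0 \<le> v'" "u' + G * v' \<le> t"
    "\<And>w. w \<in> K \<Longrightarrow> cmod (ev (q - h * a') w) \<le> u'" "\<And>w. w \<in> S \<Longrightarrow> cmod (ev a' w) \<le> v'"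
    using assms(5) by (rule residue_gaugeE) blast
  \<comment> \<open>With this cofactor the residue of \<open>p * q\<close> is the product of the
    residues, and the resulting total bound factors exactly into
    \<open>(u + G * v) * (u' + G * v')\<close>.\<close>
  define b where "b = a * q + (p - h * a) * a'"
  show ?thesis
  proof (rule residue_gaugeI[of "u * u'" "v * (u' + G * v') + u * v'" G "s * t" K "p * q" h b S])
    show "0 \<le> u * u'" "0 \<le> v * (u' + G * v') + u * v'"
      using a a' G by auto
    have "u * u' + G * (v * (u' + G * v') + u * v') = (u + G * v) * (u' + G * v')"
      by (simp add: algebra_simps)
    also have "\<dots> \<le> s * t"
    proof (intro mult_mono)
      have "0 \<le> G * v" "0 \<le> G * v'" using a a' G by auto
      then show "0 \<le> s" "0 \<le> u' + G * v'" using a a' by linarith+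
    qed (use a a' in auto)
    finally show "u * u' + G * (v * (u' + G * v') + u * v') \<le> s * t" .
  next
    fix w assume w: "w \<in> K"
    have "p * q - h * b = (p - h * a) * (q - h * a')" by (simp add: b_def algebra_simps)
    then have "ev (p * q - h * b) w = ev (p - h * a) w * ev (q - h * a') w"
      by (simp only: ev_simps)
    then show "cmod (ev (p * q - h * b) w) \<le> u * u'"
      using a a' w by (simp only: norm_mult) (intro mult_mono, auto)
  next
    fix w assume w: "w \<in> S"
    then have wK: "w \<in> K" using assms by auto
    have "ev q w = ev (q - h * a') w + ev h w * ev a' w" by simp
    also have "cmod \<dots> \<le> u' + G * v'"
    proof (intro norm_triangle_mono)
      show "cmod (ev (q - h * a') w) \<le> u'" by (rule a'(4)[OF wK])
      show "cmod (ev h w * ev a' w) \<le> G * v'"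
        unfolding norm_mult using G(1) G(2)[OF w] a'(5)[OF w] by (intro mult_mono) auto
    qed
    finally have q: "cmod (ev q w) \<le> u' + G * v'" .
    have "ev b w = ev a w * ev q w + ev (p - h * a) w * ev a' w"
      by (simp add: b_def)
    also have "cmod \<dots> \<le> v * (u' + G * v') + u * v'"
    proof (intro norm_triangle_mono)
      show "cmod (ev a w * ev q w) \<le> v * (u' + G * v')"
        unfolding norm_mult using a(2) a(5)[OF w] q by (intro mult_mono) auto
      show "cmod (ev (p - h * a) w * ev a' w) \<le> u * v'"
        unfolding norm_mult using a(1) a(4)[OF wK] a'(5)[OF w] by (intro mult_mono) auto
    qed
    finally show "cmod (ev b w) \<le> v * (u' + G * v') + u * v'" .
  qed
qed

lemma gauge_residue_gauge:
  assumes K: "compact K" and "S \<subseteq> K" and G: "0 \<le> G" "\<And>w. w \<in> S \<Longrightarrow> cmod (ev h w) \<le> G"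
    and proper: "\<And>t. residue_gauge K S G h 1 t \<Longrightarrow> 1 \<le> t"
  shows "gauge (residue_gauge K S G h) const"
proof
  show "const (a + b) = const a + const b" "const (a * b) = const a * const b" "const 1 = 1" for a b
    by (simp_all add: const_def one_pCons)
  show "0 \<le> t" if "residue_gauge K S G h a t" for a t
    using that
  proof (rule residue_gaugeE)
    fix u v :: real assume "0 \<le> u" "0 \<le> v" "u + G * v \<le> t"
    moreover from this have "0 \<le> G * v" using G by simp
    ultimately show ?thesis by linarith
  qed
  show "residue_gauge K S G h (p + q) (s + t)"
    if p: "residue_gauge K S G h p s" and q: "residue_gauge K S G h q t" for p q s t
  proof -
    obtain a u v where a: "0 \<le> u" "0 \<le> v" "u + G * v \<le> s"
      "\<And>w. w \<in> K \<Longrightarrow> cmod (ev (p - h * a) w) \<le> u" "\<And>w. w \<in> S \<Longrightarrow> cmod (ev a w) \<le> v"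
      using p by (rule residue_gaugeE) blast
    obtain a' u' v' where a': "0 \<le> u'" "0 \<le> v'" "u' + G * v' \<le> t"
      "\<And>w. w \<in> K \<Longrightarrow> cmod (ev (q - h * a') w) \<le> u'" "\<And>w. w \<in> S \<Longrightarrow> cmod (ev a' w) \<le> v'"
      using q by (rule residue_gaugeE) blast
    show ?thesis
    proof (rule residue_gaugeI[of "u + u'" "v + v'" G "s + t" K "p + q" h "a + a'" S])
      show "u + u' + G * (v + v') \<le> s + t" using a a' by (simp add: algebra_simps)
      fix w
      have "p + q - h * (a + a') = (p - h * a) + (q - h * a')" by (simp add: algebra_simps)
      then have "ev (p + q - h * (a + a')) w = ev (p - h * a) w + ev (q - h * a') w"
        by (simp only: ev_simps)
      then show "cmod (ev (p + q - h * (a + a')) w) \<le> u + u'" if "w \<in> K"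
        using a(4)[OF that] a'(4)[OF that] by (simp only:) (rule norm_triangle_mono)
      show "cmod (ev (a + a') w) \<le> v + v'" if "w \<in> S"
        using a(5)[OF that] a'(5)[OF that] by (simp add: norm_triangle_mono)
    qed (use a a' in auto)
  qed
  show "residue_gauge K S G h (p * q) (s * t)"
    if "residue_gauge K S G h p s" "residue_gauge K S G h q t" for p q s t
    using assms(2) G that by (rule residue_gauge_mult)
  show "residue_gauge K S G h (const c) (cmod c)" for c
    by (rule residue_gaugeI[of "cmod c" 0 _ _ _ _ _ 0]) auto
  show "residue_gauge K S G h p t" if "residue_gauge K S G h p s" "s \<le> t" for p s t
    using that unfolding residue_gauge_def by (meson order_trans)
  show "\<exists>t. residue_gauge K S G h p t" for p
  proof -
    obtain B where "0 \<le> B" "\<And>w. w \<in> K \<Longrightarrow> cmod (ev p w) \<le> B"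
      using ev_bounded[OF K] by blast
    then have "residue_gauge K S G h p B"
      by (intro residue_gaugeI[of B 0 _ _ _ _ _ 0]) auto
    then show ?thesis by blast
  qed
qed (rule proper)

text \<open>If the gauge is proper and the powers of \<open>f\<close> are not small,
  \<open>gauge_character\<close> yields a hull point with \<open>h = 0\<close> and modulus of
  \<open>f\<close> at least 1. If it is not proper, 1 has size \<open>t < 1\<close>, and multiplying
  \<open>f\<close> by powers of 1 shrinks its own bound.\<close>

lemma small_residue:
  assumes K: "compact K" and S: "S \<subseteq> K" and G: "0 < G" "\<And>w. w \<in> S \<Longrightarrow> cmod (ev h w) \<le> G"
    and \<kappa>: "0 \<le> \<kappa>" "\<kappa> < 1" "\<And>w. w \<in> S \<Longrightarrow> cmod (ev f w) \<le> \<kappa>"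
    and f: "\<And>w. w \<in> poly_hull K \<Longrightarrow> ev h w = 0 \<Longrightarrow> cmod (ev f w) < 1"
  obtains N where "0 < N" "residue_gauge K S G h (f ^ N) (1/4)"
proof (cases "\<forall>t. residue_gauge K S G h 1 t \<longrightarrow> 1 \<le> t")
  case True
  then interpret gauge "residue_gauge K S G h" const
    using K S G by (intro gauge_residue_gauge) auto
  have "small_powers f"
  proof (rule ccontr)
    assume "\<not> small_powers f"
    then obtain z where z: "\<And>p t. residue_gauge K S G h p t \<Longrightarrow> cmod (ev p z) \<le> t" "1 \<le> cmod (ev f z)"
      using gauge_character[OF gauge_axioms] by blast
    have "z \<in> poly_hull K"
      unfolding poly_hull_iff
    proof (intro allI impI)
      fix p t assume *: "\<forall>w\<in>K. cmod (ev p w) \<le> t"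
      show "cmod (ev p z) \<le> t"
      proof (cases "K = {}")
        case True
        then have "residue_gauge K S G h 1 0"
          using S by (intro residue_gaugeI[of 0 0 _ _ _ _ _ 0]) auto
        then show ?thesis using proper by force
      next
        case False
        then have "0 \<le> t" using * norm_ge_zero order_trans by blast
        with * show ?thesis
          by (intro z residue_gaugeI[of t 0 _ _ _ _ _ 0]) auto
      qed
    qed
    moreover have "ev h z = 0"
    proof (rule ccontr)
      assume h: "ev h z \<noteq> 0"
      \<comment> \<open>\<open>h\<close> itself is not seen to have size 0, as its cofactor 1 costs
        \<open>G\<close>. But \<open>h * f ^ n\<close> has the cofactor \<open>f ^ n\<close>, at
        most \<open>\<kappa> ^ n\<close> on \<open>S\<close>, while at \<open>z\<close> the modulus
        of \<open>f ^ n\<close> is at least 1.\<close>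
      have *: "cmod (ev h z) \<le> G * \<kappa> ^ n" for n
      proof -
        have "residue_gauge K S G h (h * f ^ n) (G * \<kappa> ^ n)"
          using \<kappa> G by (intro residue_gaugeI[of 0 "\<kappa> ^ n" _ _ _ _ _ "f ^ n"]) (auto simp: norm_power power_mono)
        then have "cmod (ev h z) * cmod (ev f z) ^ n \<le> G * \<kappa> ^ n"
          using z(1) by (force simp: norm_mult norm_power)
        moreover have "cmod (ev h z) * 1 \<le> cmod (ev h z) * cmod (ev f z) ^ n"
          using z(2) by (intro mult_left_mono) auto
        ultimately show ?thesis by simp
      qed
      obtain n where "\<kappa> ^ n < cmod (ev h z) / G"
        using real_arch_pow_inv[of "cmod (ev h z) / G" \<kappa>] h G \<kappa> by auto
      then show False using *[of n] G by (simp add: field_simps)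
    qed
    ultimately show False using f[of z] z(2) by simp
  qed
  then obtain m where "\<And>n. m \<le> n \<Longrightarrow> residue_gauge K S G h (f ^ n) (1/4)"
    unfolding small_powers_def by (metis zero_less_divide_1_iff zero_less_numeral)
  then show ?thesis using that[of "Suc m"] by (simp del: power_Suc)
next
  case False
  then obtain t where t: "t < 1" "residue_gauge K S G h 1 t" by (auto simp: not_le)
  have t0: "0 \<le> t" using t(2)
  proof (rule residue_gaugeE)
    fix u v :: real assume "0 \<le> u" "0 \<le> v" "u + G * v \<le> t"
    moreover from this have "0 \<le> G * v" using G by simp
    ultimately show ?thesis by linarith
  qed
  obtain B where B: "0 \<le> B" "\<And>w. w \<in> K \<Longrightarrow> cmod (ev f w) \<le> B"
    using ev_bounded[OF K] by blast
  have fB: "residue_gauge K S G h f B"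
    using B by (intro residue_gaugeI[of B 0 _ _ _ _ _ 0]) auto
  have mult: "residue_gauge K S G h (p * q) (s * t)" 
    if "residue_gauge K S G h p s" "residue_gauge K S G h q t" for p q s t
    using S _ _ that by (rule residue_gauge_mult) (use G in auto)
  have *: "residue_gauge K S G h f (B * t ^ k)" for k
  proof (induction k)
    case (Suc k)
    from mult[OF this t(2)] show ?case by (simp add: mult_ac)
  qed (use fB in simp)
  have "0 < 1 / (4 * (B + 1))" using B by simp
  then obtain k where k: "t ^ k < 1 / (4 * (B + 1))"
    using real_arch_pow_inv t by blast
  have "B * t ^ k \<le> (B + 1) * (1 / (4 * (B + 1)))"
    using k B t0 by (intro mult_mono) auto
  moreover have "(B + 1) * (1 / (4 * (B + 1))) = 1/4" using B(1) by (simp add: divide_simps)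
  ultimately have "B * t ^ k \<le> 1/4" by linarith
  with *[of k] have "residue_gauge K S G h f (1/4)"
    unfolding residue_gauge_def by (meson order_trans)
  then show ?thesis using that[of 1] by simp
qed

text \<open>Trapezoidal rule for the Cauchy integral of 1 over the circle of radius
  \<open>r\<close>: divided by \<open>n\<close>, the sum is near 1 inside and near 0 outside for
  large \<open>n\<close>. Writing the nodes as r over a root of unity makes x / l j a root of unity
  times x / r, so a finite geometric series gives the exact value.\<close>

lemma roots_partial_fractions:
  fixes x :: complex and r :: real and n :: nat
  assumes n: "0 < n" and r: "0 < r" and x: "x ^ n \<noteq> of_real r ^ n"
  defines "l \<equiv> \<lambda>j. of_real r / cis (2 * pi * real j / real n)"
  shows "(\<Sum>j<n. l j / (l j - x)) = of_nat n / (1 - (x / of_real r) ^ n)"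
proof -
  define w where "w j = cis (2 * pi * real j / real n)" for j
  define y where "y = x / of_real r"
  have y: "y ^ n \<noteq> 1" using x r by (simp add: y_def power_divide)
  have w0: "w j \<noteq> 0" for j by (simp add: w_def)
  have wn: "w j ^ n = 1" for j
    using n by (simp add: w_def Complex.DeMoivre cis_multiple_2pi)
  have "l j / (l j - x) = (\<Sum>i<n. (y * w j) ^ i) / (1 - y ^ n)" for j
  proof -
    have "(1 - y * w j) * (\<Sum>i<n. (y * w j) ^ i) = 1 - (y * w j) ^ n"
      by (simp only: one_diff_power_eq)
    then have "(1 - y * w j) * (\<Sum>i<n. (y * w j) ^ i) = 1 - y ^ n"
      using wn[of j] by (simp only: power_mult_distrib mult_1_right)
    moreover from this have "1 - y * w j \<noteq> 0" using y by force
    moreover have "l j / (l j - x) = 1 / (1 - y * w j)"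
    proof -
      have lj: "l j = of_real r / w j" by (simp add: l_def w_def)
      have "l j - x = l j * (1 - y * w j)"
        using w0[of j] r by (simp add: lj y_def field_simps)
      moreover have "l j \<noteq> 0" using r w0[of j] by (simp add: lj)
      ultimately show ?thesis by simp
    qed
    moreover have "1 - y ^ n \<noteq> 0" using y by simp
    moreover have "1 / c = s / d" if "c * s = d" "d \<noteq> 0" for c s d :: complex
      using that by (auto simp: field_simps)
    ultimately show ?thesis by metis
  qed
  then have "(\<Sum>j<n. l j / (l j - x)) = (\<Sum>j<n. \<Sum>i<n. (y * w j) ^ i) / (1 - y ^ n)"
    by (simp add: sum_divide_distrib)
  also have "(\<Sum>j<n. \<Sum>i<n. (y * w j) ^ i) = (\<Sum>i<n. y ^ i * (\<Sum>j<n. w j ^ i))"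
    by (subst sum.swap) (simp add: power_mult_distrib sum_distrib_left)
  also have "\<dots> = (\<Sum>i<n. if i = 0 then of_nat n else 0)"
    using n by (intro sum.cong) (auto simp: roots_of_unity_sum w_def)
  finally show ?thesis using n by (simp add: y_def sum.delta')
qed

text \<open>Compactness of the circle. Near \<open>l\<close> the same cofactor \<open>a\<close>
  still works, as replacing \<open>l\<close> by \<open>m\<close> changes the residue by
  \<open>(m - l) * a\<close>; hence the slack from 1/4 to 1/2. The product of the exponents of a
  finite subcover is a common exponent.\<close>

lemma uniform_small_residue:
  assumes K: "compact K" and S: "S \<subseteq> K" and r: "0 < r" and G: "0 < G"
    and hG: "\<And>l w. cmod l = r \<Longrightarrow> w \<in> S \<Longrightarrow> cmod (ev (g - const l) w) \<le> G"
    and \<kappa>: "0 \<le> \<kappa>" "\<kappa> < 1" "\<And>w. w \<in> S \<Longrightarrow> cmod (ev f w) \<le> \<kappa>"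
    and f: "\<And>w. w \<in> poly_hull K \<Longrightarrow> cmod (ev g w) = r \<Longrightarrow> cmod (ev f w) < 1"
  obtains N where "0 < N" "\<And>l k. cmod l = r \<Longrightarrow> residue_gauge K S G (g - const l) (f ^ (N * k)) ((1/2) ^ k)"
proof -
  let ?R = "\<lambda>l. residue_gauge K S G (g - const l)"
  have pow: "?R l (p ^ k) (t ^ k)" if l: "cmod l = r" and p: "?R l p t" for l p t k
  proof (induction k)
    case 0
    show ?case by (rule residue_gaugeI[of 1 0 _ _ _ _ _ 0]) auto
  next
    case (Suc k)
    show ?case unfolding power_Suc
      by (rule residue_gauge_mult[OF S _ _ p Suc]) (use G hG[OF l] in auto)
  qed
  have "\<exists>N d. 0 < N \<and> 0 < d \<and> (\<forall>m. cmod m = r \<longrightarrow> dist m l < d \<longrightarrow> ?R m (f ^ N) (1/2))"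
    if l: "cmod l = r" for l
  proof -
    obtain N where N: "0 < N" "?R l (f ^ N) (1/4)"
      using small_residue[OF K S G hG[OF l] \<kappa>] f l by (auto simp: eq_diff_eq)
    obtain a u v where a: "0 \<le> u" "0 \<le> v" "u + G * v \<le> 1/4"
      "\<And>w. w \<in> K \<Longrightarrow> cmod (ev (f ^ N - (g - const l) * a) w) \<le> u" "\<And>w. w \<in> S \<Longrightarrow> cmod (ev a w) \<le> v"
      using N(2) by (rule residue_gaugeE) blast
    obtain B where B: "0 \<le> B" "\<And>w. w \<in> K \<Longrightarrow> cmod (ev a w) \<le> B"
      using ev_bounded[OF K] by blast
    have "?R m (f ^ N) (1/2)" if m: "dist m l < 1 / (4 * (B + 1))" for m
    proof (rule residue_gaugeI[of "u + 1/4" v _ _ _ _ _ a])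
      show "u + 1/4 + G * v \<le> 1/2" using a by simp
      fix w assume w: "w \<in> K"
      have "ev (f ^ N - (g - const m) * a) w = ev (f ^ N - (g - const l) * a) w + (m - l) * ev a w"
        by (simp add: algebra_simps)
      moreover have "cmod ((m - l) * ev a w) \<le> 1/4"
      proof -
        have "cmod ((m - l) * ev a w) \<le> 1 / (4 * (B + 1)) * (B + 1)"
          unfolding norm_mult using m B(1) B(2)[OF w] by (intro mult_mono) (auto simp: dist_norm)
        moreover have "1 / (4 * (B + 1)) * (B + 1) = 1/4" using B(1) by (simp add: divide_simps)
        ultimately show ?thesis by linarith
      qed
      ultimately show "cmod (ev (f ^ N - (g - const m) * a) w) \<le> u + 1/4"
        using a(4)[OF w] by (simp only:) (rule norm_triangle_mono)
    qed (use a in auto)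
    moreover have "0 < 1 / (4 * (B + 1))" using B by simp
    ultimately show ?thesis using N(1) by blast
  qed
  then obtain N d where Nd: "\<And>l. cmod l = r \<Longrightarrow> 0 < N l" "\<And>l. cmod l = r \<Longrightarrow> 0 < d l"
    "\<And>l m. cmod l = r \<Longrightarrow> cmod m = r \<Longrightarrow> dist m l < d l \<Longrightarrow> ?R m (f ^ N l) (1/2)"
    by metis
  have "compact (sphere (0::complex) r)" by simp
  moreover have "sphere (0::complex) r \<subseteq> (\<Union>l\<in>sphere 0 r. ball l (d l))"
    using Nd(2) by force
  ultimately obtain T where T: "T \<subseteq> sphere 0 r" "finite T" "sphere (0::complex) r \<subseteq> (\<Union>l\<in>T. ball l (d l))"
    by (metis (no_types, lifting) compactE_image open_ball)
  define M where "M = prod N T"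
  have M: "0 < M" unfolding M_def using T Nd(1) by (intro prod_pos) auto
  show ?thesis
  proof (rule that[OF M])
    fix l k assume l: "cmod l = r"
    then obtain m where m: "m \<in> T" "dist m l < d m" using T(3) by force
    then have "?R l (f ^ N m) (1/2)"
      using Nd(3)[of m l] T(1) l by (auto simp: dist_commute)
    moreover obtain q where q: "M = N m * q"
      using dvd_prodI[OF T(2) m(1), of N] unfolding M_def by (auto elim: dvdE)
    ultimately have "?R l ((f ^ N m) ^ (q * k)) ((1/2) ^ (q * k))"
      by (intro pow[OF l])
    moreover have "q \<noteq> 0" using q M by auto
    then have "(1/2::real) ^ (q * k) \<le> (1/2) ^ k" by (intro power_decreasing) auto
    ultimately show "?R l (f ^ (M * k)) ((1/2) ^ k)"
      unfolding residue_gauge_def by (simp only: q power_mult mult.assoc) (meson order_trans)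
  qed
qed

text \<open>If \<open>f\<close> exceeded 1 in modulus at \<open>z\<close>, then for each
  \<open>k\<close> the polynomial \<open>J\<close> would be bounded on \<open>K\<close>, hence at
  \<open>z\<close>, by a constant free of \<open>k\<close>. There it equals
  \<open>ev f z ^ (N * k)\<close> over a number of modulus at most 2, up to a bounded error, which
  is absurd for large \<open>k\<close>.\<close>

lemma hull_max_principle:
  assumes K: "compact K" and r: "0 < r"
    and bd: "\<And>w. w \<in> poly_hull K \<Longrightarrow> cmod (ev g w) = r \<Longrightarrow> cmod (ev f w) < 1"
    and inn: "\<And>w. w \<in> K \<Longrightarrow> cmod (ev g w) \<le> r \<Longrightarrow> cmod (ev f w) < 1"
    and z: "z \<in> poly_hull K" "cmod (ev g z) < r"
  shows "cmod (ev f z) \<le> 1"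
proof (rule ccontr)
  assume fz: "\<not> ?thesis"
  \<comment> \<open>A margin exists because the points of \<open>K\<close> with modulus of
    \<open>f\<close> at least 1 form a compact set on which the modulus of \<open>g\<close> exceeds
    \<open>r\<close>.\<close>
  obtain \<eta> where \<eta>: "0 < \<eta>" "\<eta> < r" "\<And>w. w \<in> K \<Longrightarrow> cmod (ev g w) \<le> r + \<eta> \<Longrightarrow> cmod (ev f w) < 1"
  proof -
    define T where "T = {w \<in> K. 1 \<le> cmod (ev f w)}"
    have "T = K \<inter> {w. 1 \<le> cmod (ev f w)}" by (auto simp: T_def)
    moreover have "closed {w. 1 \<le> cmod (ev f w)}"
      by (intro closed_Collect_le continuous_intros)
    ultimately have T: "compact T" using K by (simp add: compact_Int_closed)
    show ?thesis
    proof (cases "T = {}")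
      case True
      then show ?thesis using that[of "r/2"] r by (auto simp: T_def not_le)
    next
      case False
      obtain w where w: "w \<in> T" "\<And>v. v \<in> T \<Longrightarrow> cmod (ev g w) \<le> cmod (ev g v)"
      proof -
        have "continuous_on T (\<lambda>w. cmod (ev g w))" by (intro continuous_intros)
        then show ?thesis using continuous_attains_inf[OF T False] that by blast
      qed
      have "r < cmod (ev g w)" using w(1) inn[of w] by (force simp: T_def)
      define \<eta> where "\<eta> = min (r/2) ((cmod (ev g w) - r)/2)"
      have \<eta>: "0 < \<eta>" "\<eta> < r" "r + \<eta> < cmod (ev g w)"
        using r \<open>r < cmod (ev g w)\<close> by (auto simp: \<eta>_def min_def field_simps)
      show ?thesis
        using w(2) \<eta> by (intro that[of \<eta>]) (force simp: T_def not_le[symmetric])+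
    qed
  qed
  define S where "S = {w \<in> K. r - \<eta> \<le> cmod (ev g w) \<and> cmod (ev g w) \<le> r + \<eta>}"
  obtain \<kappa> where \<kappa>: "0 \<le> \<kappa>" "\<kappa> < 1" "\<And>w. w \<in> S \<Longrightarrow> cmod (ev f w) \<le> \<kappa>"
  proof -
    have "S = K \<inter> {w. r - \<eta> \<le> cmod (ev g w)} \<inter> {w. cmod (ev g w) \<le> r + \<eta>}" by (auto simp: S_def)
    moreover have "closed {w. r - \<eta> \<le> cmod (ev g w)}" "closed {w. cmod (ev g w) \<le> r + \<eta>}"
      by (intro closed_Collect_le continuous_intros)+
    ultimately have S: "compact S" using K by (simp add: compact_Int_closed)
    show ?thesis
    proof (cases "S = {}")
      case False
      then obtain w where w: "w \<in> S" "\<And>v. v \<in> S \<Longrightarrow> cmod (ev f v) \<le> cmod (ev f w)"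
      proof -
        have "continuous_on S (\<lambda>w. cmod (ev f w))" by (intro continuous_intros)
        then show ?thesis using continuous_attains_sup[OF S False] that by blast
      qed
      then show ?thesis using \<eta>(3)[of w] by (intro that[of "cmod (ev f w)"]) (auto simp: S_def)
    qed (use that[of 0] in auto)
  qed
  have SK: "S \<subseteq> K" by (auto simp: S_def)
  have hG: "cmod (ev (g - const l) w) \<le> 3 * r" if "cmod l = r" "w \<in> S" for l w
    using norm_triangle_ineq4[of "ev g w" l] that \<eta> by (simp add: S_def)
  obtain N where N: "0 < N" "\<And>l k. cmod l = r \<Longrightarrow> residue_gauge K S (3 * r) (g - const l) (f ^ (N * k)) ((1/2) ^ k)"
  proof (rule uniform_small_residue[OF K SK r _ hG \<kappa> bd])
    show "0 < 3 * r" using r by simp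
  qed blast+
  obtain F where F: "0 \<le> F" "\<And>w. w \<in> K \<Longrightarrow> cmod (ev f w) \<le> F"
    using ev_bounded[OF K] by blast
  define \<rho> where "\<rho> = cmod (ev g z)"
  have \<rho>: "0 \<le> \<rho>" "\<rho> < r" using z by (auto simp: \<rho>_def)
  have bound: "cmod (ev f z) ^ (N * k) \<le> 2 * (2 + r / \<eta> + r / (r - \<rho>))" for k
  proof -
    \<comment> \<open>\<open>n\<close> is chosen after \<open>k\<close>. Over the inner part the
      denominator 1 - (g/r)^n stays at least 1/2; over the outer part it must beat
      \<open>F ^ (N * k)\<close>, the only bound for the power of \<open>f\<close> there, and the
      extra 1 absorbs the 1 in the denominator.\<close>
    obtain n where n: "0 < n" "((r - \<eta>) / r) ^ n \<le> 1/2" "F ^ (N * k) + 1 \<le> ((r + \<eta>) / r) ^ n"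
    proof -
      obtain n1 where n1: "((r - \<eta>) / r) ^ n1 < 1/2"
        using real_arch_pow_inv[of "1/2" "(r - \<eta>) / r"] \<eta> by auto
      have "1 < (r + \<eta>) / r" using \<eta> r by simp
      then obtain n2 where n2: "F ^ (N * k) + 1 < ((r + \<eta>) / r) ^ n2"
        using real_arch_pow by blast
      have "((r - \<eta>) / r) ^ (n1 + n2 + 1) \<le> ((r - \<eta>) / r) ^ n1"
        using \<eta> r by (intro power_decreasing) auto
      moreover have "((r + \<eta>) / r) ^ n2 \<le> ((r + \<eta>) / r) ^ (n1 + n2 + 1)"
        using \<eta> r by (intro power_increasing) auto
      ultimately show ?thesis
        using n1 n2 by (intro that[of "n1 + n2 + 1"]) (simp, (meson less_imp_le order_trans)+)
    qed
    define l where "l j = of_real r / cis (2 * pi * real j / real n)" for j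
    have lr: "cmod (l j) = r" for j using r by (simp add: l_def norm_divide)
    have "\<exists>a. (\<forall>w\<in>K. cmod (ev (f ^ (N * k) - (g - const (l j)) * a) w) \<le> 1) \<and> (\<forall>w\<in>S. cmod (ev a w) \<le> 1 / r)" for j
      using N(2)[OF lr[of j], of k]
    proof (rule residue_gaugeE)
      fix a u v
      assume a: "0 \<le> u" "0 \<le> v" "u + 3 * r * v \<le> (1/2) ^ k"
        "\<And>w. w \<in> K \<Longrightarrow> cmod (ev (f ^ (N * k) - (g - const (l j)) * a) w) \<le> u" "\<And>w. w \<in> S \<Longrightarrow> cmod (ev a w) \<le> v"
      have "(1/2::real) ^ k \<le> 1" by (simp add: power_le_one)
      moreover have "0 \<le> r * v" using a r by simp
      ultimately have "u \<le> 1" "r * v \<le> 1" using a(1,3) by linarith+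
      then have "u \<le> 1" "v \<le> 1 / r" using r by (auto simp: field_simps)
      then show ?thesis using a(4,5) order_trans by (intro exI[of _ a]) blast
    qed
    then obtain a where a: "\<And>j w. w \<in> K \<Longrightarrow> cmod (ev (f ^ (N * k) - (g - const (l j)) * a j) w) \<le> 1"
      "\<And>j w. w \<in> S \<Longrightarrow> cmod (ev (a j) w) \<le> 1 / r" by metis
    \<comment> \<open>A discretised Cauchy integral of f^(N k) over the circle, with f^(N k) / (l - g) replaced by the
      polynomial cofactors a. The control of a on S covers the points where the kernel is singular.\<close>
    define J where "J = const (- 1 / of_nat n) * (\<Sum>j<n. const (l j) * a j)"
    define b where "b j = f ^ (N * k) - (g - const (l j)) * a j" for j
    define E where "E w = (\<Sum>j<n. l j / (l j - ev g w) * ev (b j) w) / of_nat n" for w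
    \<comment> \<open>The relation \<open>f ^ (N * k) = b j + (g - const (l j)) * a j\<close> shows
      that - a j is (f^(N k) - b j) / (l j - g). The mean of the first part is given by
      \<open>roots_partial_fractions\<close>, that of the second is \<open>E\<close>.\<close>
    have J: "ev J w = ev f w ^ (N * k) / (1 - (ev g w / of_real r) ^ n) - E w"
      if x: "cmod (ev g w) \<noteq> r" for w
    proof -
      have xl: "l j - ev g w \<noteq> 0" for j using x lr[of j] by auto
      have xn: "ev g w ^ n \<noteq> of_real r ^ n"
      proof
        assume "ev g w ^ n = of_real r ^ n"
        then have "cmod (ev g w) ^ n = r ^ n" using r by (metis abs_of_pos norm_of_real norm_power)
        then show False using x r n(1) power_eq_imp_eq_base[of "cmod (ev g w)" n r] by simp
      qed
      have "- (l j * ev (a j) w) = ev f w ^ (N * k) * (l j / (l j - ev g w)) - l j / (l j - ev g w) * ev (b j) w" for j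
      proof -
        have "l j / (l j - ev g w) * (l j - ev g w) = l j" using xl[of j] by simp
        moreover have "- (q * d * A) = B * q - q * (B + d * A)" for q d A B :: complex
          by (simp add: algebra_simps)
        ultimately have "- (l j * ev (a j) w)
            = ev f w ^ (N * k) * (l j / (l j - ev g w)) - l j / (l j - ev g w) * (ev f w ^ (N * k) + (l j - ev g w) * ev (a j) w)"
          by metis
        moreover have "ev (b j) w = ev f w ^ (N * k) + (l j - ev g w) * ev (a j) w"
          by (simp add: b_def algebra_simps)
        ultimately show ?thesis by simp
      qed
      then have "- (\<Sum>j<n. l j * ev (a j) w) = ev f w ^ (N * k) * (\<Sum>j<n. l j / (l j - ev g w)) - (\<Sum>j<n. l j / (l j - ev g w) * ev (b j) w)"
        by (simp only: sum_negf[symmetric] sum_subtractf sum_distrib_left)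
      also have "(\<Sum>j<n. l j / (l j - ev g w)) = of_nat n / (1 - (ev g w / of_real r) ^ n)"
        unfolding l_def by (rule roots_partial_fractions[OF n(1) r xn])
      finally have *: "- (\<Sum>j<n. l j * ev (a j) w) = ev f w ^ (N * k) * (of_nat n / (1 - (ev g w / of_real r) ^ n))
          - (\<Sum>j<n. l j / (l j - ev g w) * ev (b j) w)" .
      have "ev J w = - (\<Sum>j<n. l j * ev (a j) w) / of_nat n" by (simp add: J_def)
      note this[unfolded *]
      then show ?thesis using n(1) by (simp add: E_def diff_divide_distrib)
    qed
    have E: "cmod (E w) \<le> r / d"
      if "0 < d" "d \<le> \<bar>r - cmod (ev g w)\<bar>" "\<And>j. cmod (ev (b j) w) \<le> 1" for w d
    proof -
      have "cmod (l j / (l j - ev g w) * ev (b j) w) \<le> r / d * 1" for j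
        unfolding norm_mult norm_divide lr
      proof (intro mult_mono divide_left_mono that)
        show "d \<le> cmod (l j - ev g w)"
          using that norm_triangle_ineq3[of "l j" "ev g w"] lr[of j] by linarith
        then show "0 < cmod (l j - ev g w) * d" using that by (intro mult_pos_pos) linarith+
      qed (use r that in auto)
      then have "cmod (\<Sum>j<n. l j / (l j - ev g w) * ev (b j) w) \<le> (\<Sum>j<n. r / d)"
        by (intro sum_norm_le) simp
      then show ?thesis using n(1) by (simp add: E_def norm_divide field_simps)
    qed
    have JK: "cmod (ev J w) \<le> 2 + r / \<eta>" if w: "w \<in> K" for w
    proof -
      have b1: "cmod (ev (b j) w) \<le> 1" for j using a(1)[OF w] by (simp add: b_def)
      consider "cmod (ev g w) < r - \<eta>" | "r + \<eta> < cmod (ev g w)" | "w \<in> S"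
        using w by (force simp: S_def)
      then show ?thesis
      proof cases
        case 1
        have "(cmod (ev g w) / r) ^ n \<le> ((r - \<eta>) / r) ^ n"
          using 1 r by (intro power_mono divide_right_mono) auto
        then have "cmod ((ev g w / of_real r) ^ n) \<le> 1/2"
          using n(2) r by (simp add: norm_power norm_divide)
        then have "1/2 \<le> cmod (1 - (ev g w / of_real r) ^ n)"
          using norm_triangle_ineq2[of 1 "(ev g w / of_real r) ^ n"] by simp
        moreover have "cmod (ev f w ^ (N * k)) \<le> 1"
          using \<eta>(3)[OF w] 1 \<eta>(1) by (simp add: norm_power power_le_one)
        ultimately have "cmod (ev f w ^ (N * k) / (1 - (ev g w / of_real r) ^ n)) \<le> 1 / (1/2)"
          unfolding norm_divide by (intro frac_le) auto
        moreover have "cmod (E w) \<le> r / \<eta>" using 1 \<eta> by (intro E b1) auto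
        ultimately show ?thesis
          using 1 \<eta>(1) norm_triangle_ineq4[of "ev f w ^ (N * k) / (1 - (ev g w / of_real r) ^ n)" "E w"]
          by (subst J) auto
      next
        case 2
        have "((r + \<eta>) / r) ^ n \<le> (cmod (ev g w) / r) ^ n"
          using 2 r \<eta> by (intro power_mono divide_right_mono) auto
        then have "F ^ (N * k) + 1 \<le> cmod ((ev g w / of_real r) ^ n)"
          using n(3) r by (simp add: norm_power norm_divide)
        then have "F ^ (N * k) \<le> cmod (1 - (ev g w / of_real r) ^ n)"
          using norm_triangle_ineq2[of "(ev g w / of_real r) ^ n" 1] by (simp add: norm_minus_commute)
        moreover have "cmod (ev f w ^ (N * k)) \<le> F ^ (N * k)"
          using F(2)[OF w] by (simp add: norm_power power_mono)
        ultimately have "cmod (ev f w ^ (N * k) / (1 - (ev g w / of_real r) ^ n)) \<le> 1"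
          by (simp add: norm_divide divide_le_eq_1)
        moreover have "cmod (E w) \<le> r / \<eta>" using 2 \<eta> by (intro E b1) auto
        ultimately show ?thesis
          using 2 \<eta>(1) norm_triangle_ineq4[of "ev f w ^ (N * k) / (1 - (ev g w / of_real r) ^ n)" "E w"]
          by (subst J) auto
      next
        case 3
        have "cmod (l j * ev (a j) w) \<le> r * (1 / r)" for j
          unfolding norm_mult lr using a(2)[OF 3] r by (intro mult_left_mono) auto
        then have "cmod (\<Sum>j<n. l j * ev (a j) w) \<le> (\<Sum>j<n. 1)"
          using r by (intro sum_norm_le) simp
        then have "cmod (ev J w) \<le> 1" using n(1) by (simp add: J_def norm_divide norm_mult field_simps)
        moreover have "0 \<le> r / \<eta>" using r \<eta> by simp
        ultimately show ?thesis by linarith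
      qed
    qed
    have "cmod (ev J z) \<le> 2 + r / \<eta>" by (rule poly_hullD[OF z(1) JK])
    moreover have "cmod (E z) \<le> r / (r - \<rho>)"
      using a(1) by (intro E poly_hullD[OF z(1)]) (use \<rho> in \<open>auto simp: \<rho>_def b_def\<close>)
    moreover have "ev f z ^ (N * k) / (1 - (ev g z / of_real r) ^ n) = ev J z + E z"
      using J[of z] z(2) by simp
    ultimately have 1: "cmod (ev f z ^ (N * k) / (1 - (ev g z / of_real r) ^ n)) \<le> 2 + r / \<eta> + r / (r - \<rho>)"
      using norm_triangle_ineq[of "ev J z" "E z"] by simp
    have lt: "cmod ((ev g z / of_real r) ^ n) < 1"
      using n(1) z(2) r by (simp add: norm_power norm_divide power_less_one_iff)
    have 2: "cmod (1 - (ev g z / of_real r) ^ n) \<le> 2"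
      using norm_triangle_ineq4[of 1 "(ev g z / of_real r) ^ n"] lt by simp
    have "1 - (ev g z / of_real r) ^ n \<noteq> 0" using lt by auto
    then have "cmod (ev f z) ^ (N * k) = cmod (1 - (ev g z / of_real r) ^ n) * cmod (ev f z ^ (N * k) / (1 - (ev g z / of_real r) ^ n))"
      by (simp add: norm_divide norm_power)
    also have "\<dots> \<le> 2 * (2 + r / \<eta> + r / (r - \<rho>))"
      using 1 2 by (intro mult_mono) auto
    finally show ?thesis .
  qed
  have "1 < cmod (ev f z) ^ N" using fz N(1) by (simp add: one_less_power)
  then obtain k where "2 * (2 + r / \<eta> + r / (r - \<rho>)) < (cmod (ev f z) ^ N) ^ k"
    using real_arch_pow by blast
  then show False using bound[of k] by (simp add: power_mult)
qed

section \<open>Local peaks on the hull\<close>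

lemma poly_hull_empty [simp]: "poly_hull {} = {}"
  using poly_hullD[of _ "{}" 1 "-1"] by force

lemma poly_hull_mono: "X \<subseteq> Y \<Longrightarrow> poly_hull X \<subseteq> poly_hull Y"
  unfolding subset_iff poly_hull_iff by blast

lemma poly_hull_idem: "X \<subseteq> poly_hull K \<Longrightarrow> poly_hull X \<subseteq> poly_hull K"
  unfolding subset_iff poly_hull_iff by blast

text \<open>Dividing \<open>p\<close> by \<open>t + e\<close> produces the strict bound that
  \<open>hull_max_principle\<close> asks for. A negative \<open>t\<close> forces the set to be
  empty; then the constant 2 would satisfy the bound vacuously, and 2 \<le> 1 would follow.\<close>

lemma poly_hull_lemniscate:
  assumes K: "compact K" and r: "0 < r" and z: "z \<in> poly_hull K" "cmod (ev g z) \<le> r"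
  shows "z \<in> poly_hull ({w \<in> poly_hull K. cmod (ev g w) = r} \<union> {w \<in> K. cmod (ev g w) \<le> r})"
    (is "z \<in> poly_hull ?Y")
proof (cases "cmod (ev g z) = r")
  case True
  then show ?thesis using z subset_poly_hull[of ?Y] by auto
next
  case False
  have max: "cmod (ev f z) \<le> 1" if "\<And>w. w \<in> ?Y \<Longrightarrow> cmod (ev f w) < 1" for f
    by (rule hull_max_principle[OF K r _ _ z(1), of g]) (use that z False in auto)
  show ?thesis
  proof (intro poly_hull_iff[THEN iffD2] allI impI)
    fix p t assume t: "\<forall>w\<in>?Y. cmod (ev p w) \<le> t"
    show "cmod (ev p z) \<le> t"
    proof (cases "0 \<le> t")
      case True
      show ?thesis
      proof (rule field_le_epsilon)
        fix e :: real assume e: "0 < e"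
        have "cmod (ev (const (1 / of_real (t + e)) * p) z) \<le> 1"
        proof (rule max)
          fix w assume "w \<in> ?Y"
          then have "cmod (ev p w) \<le> t" using t by blast
          then show "cmod (ev (const (1 / of_real (t + e)) * p) w) < 1"
            using True e by (simp add: norm_mult norm_divide del: of_real_add)
        qed
        then show "cmod (ev p z) \<le> t + e"
          using True e by (simp add: norm_mult norm_divide del: of_real_add)
      qed
    next
      case False
      have "?Y = {}"
      proof (rule ccontr)
        assume "?Y \<noteq> {}"
        then obtain w where "cmod (ev p w) \<le> t" using t by blast
        then show False using False norm_ge_zero[of "ev p w"] by linarith
      qed
      then have "cmod (ev (const 2) z) \<le> 1" by (intro max) blast
      then show ?thesis by simp
    qed
  qed
qed

text \<open>The second application of \<open>poly_hull_lemniscate\<close> is to \<open>Y\<close>,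
  the outcome of the first, and not to \<open>K\<close>: the hull of \<open>Y\<close> remains both
  in the hull of \<open>K\<close> and in the cylinder over the first disc.\<close>

lemma poly_hull_bidisc:
  assumes K: "compact K" and r: "0 < r"
    and z: "z \<in> poly_hull K" "cmod (fst z - a) \<le> r" "cmod (snd z - b) \<le> r"
    and disj: "\<And>w. w \<in> K \<Longrightarrow> cmod (fst w - a) \<le> r \<Longrightarrow> cmod (snd w - b) \<le> r \<Longrightarrow> False"
  shows "z \<in> poly_hull {w \<in> poly_hull K. cmod (fst w - a) \<le> r \<and> cmod (snd w - b) \<le> r \<and>
    (cmod (fst w - a) = r \<or> cmod (snd w - b) = r)}"
proof -
  define Y where "Y = {w \<in> poly_hull K. cmod (ev (X1 - const a) w) = r} \<union> {w \<in> K. cmod (ev (X1 - const a) w) \<le> r}"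
  have zY: "z \<in> poly_hull Y"
    unfolding Y_def using z by (intro poly_hull_lemniscate[OF K r]) auto
  have "Y = poly_hull K \<inter> {w. cmod (ev (X1 - const a) w) = r} \<union> K \<inter> {w. cmod (ev (X1 - const a) w) \<le> r}"
    by (auto simp: Y_def)
  moreover have "closed {w. cmod (ev (X1 - const a) w) = r}" "closed {w. cmod (ev (X1 - const a) w) \<le> r}"
    by (intro closed_Collect_eq closed_Collect_le continuous_intros)+
  ultimately have Y: "compact Y"
    using K compact_poly_hull[OF K] by (simp add: compact_Int_closed compact_Un)
  have YL: "poly_hull Y \<subseteq> poly_hull K"
    using subset_poly_hull[of K] by (intro poly_hull_idem) (auto simp: Y_def)
  have Yr: "cmod (fst w - a) \<le> r" if "w \<in> poly_hull Y" for w
    using poly_hullD[OF that, of "X1 - const a" r] by (auto simp: Y_def)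
  have "z \<in> poly_hull ({w \<in> poly_hull Y. cmod (ev (X2 - const b) w) = r} \<union> {w \<in> Y. cmod (ev (X2 - const b) w) \<le> r})"
    using z by (intro poly_hull_lemniscate[OF Y r zY]) auto
  moreover have "{w \<in> poly_hull Y. cmod (ev (X2 - const b) w) = r} \<union> {w \<in> Y. cmod (ev (X2 - const b) w) \<le> r}
      \<subseteq> {w \<in> poly_hull K. cmod (fst w - a) \<le> r \<and> cmod (snd w - b) \<le> r \<and>
          (cmod (fst w - a) = r \<or> cmod (snd w - b) = r)}"
  proof
    fix w assume "w \<in> {w \<in> poly_hull Y. cmod (ev (X2 - const b) w) = r} \<union> {w \<in> Y. cmod (ev (X2 - const b) w) \<le> r}"
    then show "w \<in> {w \<in> poly_hull K. cmod (fst w - a) \<le> r \<and> cmod (snd w - b) \<le> r \<and>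
          (cmod (fst w - a) = r \<or> cmod (snd w - b) = r)}"
    proof
      assume "w \<in> {w \<in> poly_hull Y. cmod (ev (X2 - const b) w) = r}"
      then show ?thesis using Yr[of w] YL by auto
    next
      assume "w \<in> {w \<in> Y. cmod (ev (X2 - const b) w) \<le> r}"
      then have w: "w \<in> Y" "cmod (snd w - b) \<le> r" by simp_all
      then show ?thesis using disj[of w] unfolding Y_def by auto
    qed
  qed
  ultimately show ?thesis using poly_hull_mono by blast
qed

text \<open>A large constant M turns a strict inequality between real parts into one between moduli.\<close>

lemma poly_hull_Re:
  assumes X: "compact X" and z: "z \<in> poly_hull X" and c: "0 < c"
    and q: "\<And>w. w \<in> X \<Longrightarrow> Re (ev q w) \<le> Re (ev q z) - c"
  shows False
proof -
  define p where "p = q - const (ev q z)"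
  obtain B where B: "0 \<le> B" "\<And>w. w \<in> X \<Longrightarrow> cmod (ev p w) \<le> B"
    using ev_bounded[OF X] by blast
  \<comment> \<open>In the expansion of the square of the modulus of M + p, the gain
    \<open>2 * M * c\<close> must outweigh \<open>B\<^sup>2\<close>; since
    \<open>B\<^sup>2 < M * c\<close>, half of it survives.\<close>
  define M where "M = B\<^sup>2 / c + 1"
  have M: "0 < M" "B\<^sup>2 < M * c"
    using c by (simp_all add: M_def add_nonneg_pos distrib_right)
  define t where "t = sqrt (M\<^sup>2 - M * c)"
  have "cmod (ev (const M + p) w) \<le> t" if w: "w \<in> X" for w
  proof -
    have "(cmod (ev (const M + p) w))\<^sup>2 = M\<^sup>2 + 2 * M * Re (ev p w) + (cmod (ev p w))\<^sup>2"
      unfolding cmod_power2 by (simp add: power2_eq_square algebra_simps)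
    also have "\<dots> \<le> M\<^sup>2 + 2 * M * (- c) + B\<^sup>2"
      using B(2)[OF w] q[OF w] M(1) by (intro add_mono mult_left_mono power_mono) (auto simp: p_def)
    also have "\<dots> \<le> M\<^sup>2 - M * c" using M by (simp add: algebra_simps)
    finally show ?thesis unfolding t_def by (rule real_le_rsqrt)
  qed
  then have "cmod (ev (const M + p) z) \<le> t" by (rule poly_hullD[OF z])
  moreover have "cmod (ev (const M + p) z) = M" using M by (simp add: p_def)
  moreover have "t < M" unfolding t_def using M c by (intro real_less_lsqrt) auto
  ultimately show False by linarith
qed

text \<open>Turns a lexicographic condition, first \<open>u\<close> and then \<open>l\<close>, into
  a single one. On the compact set where \<open>l \<ge> 0\<close>, \<open>u\<close> is bounded away
  from 0, so a large multiple of it outweighs the maximum of \<open>l\<close>; elsewhere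
  \<open>l\<close> is already negative.\<close>

lemma penalty:
  fixes u l :: "'a::topological_space \<Rightarrow> real"
  assumes X: "compact X" and u: "continuous_on X u" and l: "continuous_on X l"
    and neg: "\<And>w. w \<in> X \<Longrightarrow> u w \<le> 0" "\<And>w. w \<in> X \<Longrightarrow> u w = 0 \<Longrightarrow> l w < 0"
  obtains B c where "0 \<le> B" "0 < c" "\<And>w. w \<in> X \<Longrightarrow> B * u w + l w \<le> - c"
proof (cases "X = {}")
  case True
  then show ?thesis using that[of 0 1] by simp
next
  case ne: False
  obtain B where B: "0 \<le> B" "\<And>w. w \<in> X \<Longrightarrow> B * u w + l w < 0"
  proof (cases "{w \<in> X. 0 \<le> l w} = {}")
    case True
    then have "\<And>w. w \<in> X \<Longrightarrow> 0 * u w + l w < 0" by auto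
    then show ?thesis by (rule that[OF order_refl])
  next
    case False
    have "{w \<in> X. 0 \<le> l w} = X \<inter> l -` {0..}" by auto
    then have Y: "compact {w \<in> X. 0 \<le> l w}"
      using closedin_compact[OF X continuous_closedin_preimage[OF l closed_atLeast]] by simp
    have "continuous_on {w \<in> X. 0 \<le> l w} u" by (rule continuous_on_subset[OF u]) auto
    then obtain y where y: "y \<in> X" "0 \<le> l y" "\<And>w. w \<in> X \<Longrightarrow> 0 \<le> l w \<Longrightarrow> u w \<le> u y"
      using continuous_attains_sup[OF Y False] by blast
    have uy: "u y < 0" using neg[OF y(1)] y(2) by linarith
    obtain v where v: "v \<in> X" "\<And>w. w \<in> X \<Longrightarrow> l w \<le> l v"
      using continuous_attains_sup[OF X ne l] by blast
    have lv: "0 \<le> l v" using v(2)[OF y(1)] y(2) by linarith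
    define B where "B = (l v + 1) / (- u y)"
    have B: "0 \<le> B" "B * u y = - (l v + 1)" using uy lv by (auto simp: B_def field_simps)
    show ?thesis
    proof (rule that[OF B(1)])
      fix w assume w: "w \<in> X"
      show "B * u w + l w < 0"
      proof (cases "0 \<le> l w")
        case True
        then have "B * u w \<le> B * u y" using y(3)[OF w] B(1) by (intro mult_left_mono)
        then show ?thesis using v(2)[OF w] B(2) by linarith
      next
        case False
        have "B * u w \<le> 0" using B(1) neg(1)[OF w] by (rule mult_nonneg_nonpos)
        then show ?thesis using False by linarith
      qed
    qed
  qed
  have "continuous_on X (\<lambda>w. B * u w + l w)" by (intro continuous_intros u l)
  then obtain w where "w \<in> X" "\<And>v. v \<in> X \<Longrightarrow> B * u v + l v \<le> B * u w + l w"
    using continuous_attains_sup[OF X ne] by blast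
  then show ?thesis using that[of B "- (B * u w + l w)"] B by force
qed

text \<open>The average \<open>u\<close> of 1 and \<open>cnj c * P\<close> has modulus 1 on the
  fibre \<open>P = c\<close> and less on the rest of \<open>K\<close>. If \<open>q\<close> separated
  \<open>z\<close> from the fibre, a high power \<open>u ^ m\<close> would make
  \<open>q * u ^ m\<close> separate \<open>z\<close> from all of \<open>K\<close>, because
  \<open>u\<close> is 1 at \<open>z\<close>.\<close>

lemma poly_hull_peak_fibre:
  assumes K: "compact K" and P: "\<And>w. w \<in> K \<Longrightarrow> cmod (ev P w) = 1"
    and z: "z \<in> poly_hull K" "cmod (ev P z) = 1"
  shows "z \<in> poly_hull {w \<in> K. ev P w = ev P z}" (is "_ \<in> poly_hull ?F")
proof (rule ccontr)
  assume "\<not> ?thesis"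
  then obtain q0 t0 where q0: "\<And>w. w \<in> ?F \<Longrightarrow> cmod (ev q0 w) \<le> t0" "t0 < cmod (ev q0 z)"
    unfolding poly_hull_iff by (auto simp: not_le)
  obtain q t where q: "\<And>w. w \<in> ?F \<Longrightarrow> cmod (ev q w) \<le> t" "t < cmod (ev q z)" "0 \<le> t"
  proof (cases "0 \<le> t0")
    case True
    then show ?thesis using that q0 by blast
  next
    case False
    have "?F = {}"
    proof (rule ccontr)
      assume "?F \<noteq> {}"
      then obtain w where "cmod (ev q0 w) \<le> t0" using q0(1) by blast
      then show False using False norm_ge_zero[of "ev q0 w"] by linarith
    qed
    then show ?thesis by (intro that[of 1 0]) auto
  qed
  define s where "s = (t + cmod (ev q z)) / 2"
  have s: "0 < s" "t < s" "s < cmod (ev q z)" using q(2,3) by (auto simp: s_def)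
  define c where "c = ev P z"
  define u where "u = const (1/2) * (1 + const (cnj c) * P)"
  have c: "cnj c * c = 1" "cmod c = 1"
    using z(2) by (auto simp: c_def complex_norm_square[symmetric] mult.commute)
  have u1: "cmod (ev u w) \<le> 1" if "w \<in> K" for w
  proof -
    have "cmod (1 + cnj c * ev P w) \<le> 1 + 1"
      using P[OF that] c(2) by (intro norm_triangle_mono) (auto simp: norm_mult)
    then show ?thesis by (simp add: u_def norm_mult)
  qed
  have uz: "ev u z = 1" using c(1) by (simp add: u_def flip: c_def)
  have ult: "cmod (ev u w) < 1" if w: "w \<in> K" "ev P w \<noteq> c" for w
  proof -
    define x where "x = cnj c * ev P w"
    have x: "cmod x = 1" using c P[OF w(1)] by (simp add: x_def norm_mult)
    have "x \<noteq> 1"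
    proof
      assume "x = 1"
      then have "c * (cnj c * ev P w) = c" by (simp add: x_def)
      then have "(cnj c * c) * ev P w = c" by (simp only: mult_ac)
      then show False using w(2) c(1) by simp
    qed
    have "(Re x)\<^sup>2 + (Im x)\<^sup>2 = 1" using x by (simp add: cmod_power2[symmetric])
    then have "Re x < 1"
      using \<open>x \<noteq> 1\<close> abs_Re_le_cmod[of x] x
      by (cases "Re x = 1") (auto simp: complex_eq_iff)
    have "(cmod (1 + x))\<^sup>2 = 2 + 2 * Re x"
      using \<open>(Re x)\<^sup>2 + (Im x)\<^sup>2 = 1\<close> unfolding cmod_power2 by (simp add: power2_eq_square algebra_simps)
    then have "(cmod (1 + x))\<^sup>2 < 2\<^sup>2" using \<open>Re x < 1\<close> by simp
    then have "cmod (1 + x) < 2" by (rule power2_less_imp_less) simp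
    then show ?thesis by (simp add: u_def norm_mult flip: x_def)
  qed
  define T where "T = {w \<in> K. s \<le> cmod (ev q w)}"
  obtain \<kappa> where \<kappa>: "0 \<le> \<kappa>" "\<kappa> < 1" "\<And>w. w \<in> T \<Longrightarrow> cmod (ev u w) \<le> \<kappa>"
  proof (cases "T = {}")
    case True
    then show ?thesis using that[of 0] by simp
  next
    case False
    have "T = K \<inter> {w. s \<le> cmod (ev q w)}" by (auto simp: T_def)
    moreover have "closed {w. s \<le> cmod (ev q w)}" by (intro closed_Collect_le continuous_intros)
    ultimately have T: "compact T" using K by (simp add: compact_Int_closed)
    have "continuous_on T (\<lambda>w. cmod (ev u w))" by (intro continuous_intros)
    then obtain w where w: "w \<in> T" "\<And>v. v \<in> T \<Longrightarrow> cmod (ev u v) \<le> cmod (ev u w)"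
      using continuous_attains_sup[OF T False] by blast
    have "ev P w \<noteq> c"
      using w(1) q(1)[of w] s(2) by (force simp: T_def c_def)
    then show ?thesis using w ult[of w] by (intro that[of "cmod (ev u w)"]) (auto simp: T_def)
  qed
  obtain B where B: "0 \<le> B" "\<And>w. w \<in> K \<Longrightarrow> cmod (ev q w) \<le> B"
    using ev_bounded[OF K] by blast
  have "0 < s / (B + 1)" using s(1) B(1) by simp
  then obtain m where m: "\<kappa> ^ m < s / (B + 1)"
    using real_arch_pow_inv \<kappa>(2) by blast
  have "cmod (ev (q * u ^ m) w) \<le> s" if w: "w \<in> K" for w
  proof (cases "w \<in> T")
    case True
    have "cmod (ev (q * u ^ m) w) \<le> (B + 1) * \<kappa> ^ m"
      using B(2)[OF w] \<kappa>(3)[OF True] \<kappa>(1) B(1)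
      by (auto simp: norm_mult norm_power intro!: mult_mono power_mono)
    also have "\<dots> \<le> s" using m B(1) by (simp add: field_simps)
    finally show ?thesis .
  next
    case False
    then have "cmod (ev q w) * cmod (ev u w) ^ m \<le> s * 1"
      using w u1[OF w] s(1) by (intro mult_mono power_le_one) (auto simp: T_def)
    then show ?thesis by (simp add: norm_mult norm_power)
  qed
  then have "cmod (ev (q * u ^ m) z) \<le> s" by (rule poly_hullD[OF z(1)])
  then show False using s(3) uz by simp
qed

lemma holomorphic_approx_ball:
  assumes "f holomorphic_on ball z R" "r < R" "0 < e" "0 \<le> r"
  obtains a n where "\<And>x. cmod (x - z) \<le> r \<Longrightarrow> cmod ((\<Sum>i<n. a i * (x - z) ^ i) - f x) < (e::real)"
proof -
  define a where "a i = (deriv ^^ i) f z / fact i" for i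
  \<comment> \<open>Convergence at this intermediate radius puts the radius of convergence strictly
    above \<open>r\<close>, so the Taylor sums converge uniformly on the closed disc of radius
    \<open>r\<close>.\<close>
  define d where "d = (r + R) / 2"
  have d: "0 \<le> d" "r < d" "d < R" using assms by (auto simp: d_def)
  have sums: "(\<lambda>i. a i * (x - z) ^ i) sums f x" if "cmod (x - z) < R" for x
    unfolding a_def using that
    by (intro holomorphic_power_series[OF assms(1)]) (simp add: dist_norm norm_minus_commute)
  have "(\<lambda>i. a i * of_real d ^ i) sums f (z + of_real d)"
    using sums[of "z + of_real d"] d by simp
  then have "summable (\<lambda>i. a i * of_real d ^ i)" by (rule sums_summable)
  then have "ereal (norm (complex_of_real d)) \<le> conv_radius a" by (rule conv_radius_geI)
  then have "ereal d \<le> conv_radius a" using d(1) by simp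
  then have "ereal r < conv_radius a"
    using d(2) less_le_trans[of "ereal r" "ereal d"] by simp
  note lim = uniform_limitD[OF powser_uniform_limit[OF this, of z] assms(3)]
  obtain n where n: "\<And>x. x \<in> cball z r \<Longrightarrow> dist (\<Sum>i<n. a i * (x - z) ^ i) (\<Sum>i. a i * (x - z) ^ i) < e"
    using lim unfolding eventually_sequentially by blast
  show ?thesis
  proof (rule that[of a n])
    fix x assume x: "cmod (x - z) \<le> r"
    then have "(\<Sum>i. a i * (x - z) ^ i) = f x"
      using sums_unique[OF sums, of x] assms(2) by simp
    then show "cmod ((\<Sum>i<n. a i * (x - z) ^ i) - f x) < e"
      using n[of x] x by (simp add: dist_norm norm_minus_commute)
  qed
qed

text \<open>A Tietze extension \<Psi> of \<psi> is no longer a logarithm off \<open>K\<close>, but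
  \<open>ev P w * exp (- \<Psi> w)\<close> is 1 on \<open>K\<close>. Where it is close to 1, its
  principal logarithm is the required correction.\<close>

lemma logarithm_near:
  fixes K :: "(complex \<times> complex) set"
  assumes K: "compact K" and \<psi>: "continuous_on K \<psi>" "\<And>w. w \<in> K \<Longrightarrow> ev P w = exp (\<psi> w)"
  obtains W \<phi> where "open W" "K \<subseteq> W" "continuous_on W \<phi>" "\<And>w. w \<in> W \<Longrightarrow> ev P w = exp (\<phi> w)"
proof -
  have "closedin (top_of_set UNIV) K" using K by (simp add: compact_imp_closed)
  then obtain \<Psi> where \<Psi>: "continuous_on UNIV \<Psi>" "\<And>w. w \<in> K \<Longrightarrow> \<Psi> w = \<psi> w"
    using Tietze_unbounded[OF \<psi>(1)] by blast
  define e where "e w = ev P w * exp (- \<Psi> w)" for w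
  have e: "continuous_on A e" for A
    unfolding e_def using continuous_on_subset[OF \<Psi>(1), of A] by (intro continuous_intros) auto
  define W where "W = {w. cmod (e w - 1) < 1}"
  define \<phi> where "\<phi> w = \<Psi> w + Ln (e w)" for w
  have Re: "0 < Re (e w)" if "w \<in> W" for w
    using that abs_Re_le_cmod[of "e w - 1"] by (simp add: W_def)
  show ?thesis
  proof (rule that)
    show "open W" unfolding W_def by (intro open_Collect_less continuous_intros e)
    show "K \<subseteq> W"
      by (auto simp: W_def e_def \<Psi>(2) \<psi>(2) simp flip: exp_add)
    show "continuous_on W \<phi>"
      unfolding \<phi>_def using continuous_on_subset[OF \<Psi>(1), of W] Re
      by (intro continuous_intros e) (force simp: complex_nonpos_Reals_iff)+
    show "ev P w = exp (\<phi> w)" if "w \<in> W" for w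
    proof -
      have "e w \<noteq> 0" using Re[OF that] by auto
      then have "exp (\<phi> w) = exp (\<Psi> w) * (ev P w * exp (- \<Psi> w))"
        by (simp add: \<phi>_def exp_add e_def)
      then show ?thesis by (simp add: exp_minus)
    qed
  qed
qed

text \<open>\<open>K\<close> lies over the unit circle, so if the hull missed the circle of radius
  \<open>r\<close>, then \<open>poly_hull_lemniscate\<close> would put \<open>z\<close> into the
  hull of the empty set.\<close>

lemma poly_hull_annulus:
  assumes K: "compact K" and P: "\<And>w. w \<in> K \<Longrightarrow> cmod (ev P w) = 1"
    and z: "z \<in> poly_hull K" and r: "cmod (ev P z) \<le> r" "0 < r" "r < 1"
  obtains w where "w \<in> poly_hull K" "cmod (ev P w) = r"
proof -
  have "{w \<in> K. cmod (ev P w) \<le> r} = {}" using P r(3) by fastforce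
  then have "{w \<in> poly_hull K. cmod (ev P w) = r} \<noteq> {}"
    using poly_hull_lemniscate[OF K r(2) z r(1)] poly_hull_empty by (metis Un_empty_right empty_iff)
  then show ?thesis using that by blast
qed

text \<open>A maximum point z of largest norm becomes a strict peak after adding a small multiple of the
  linear function w \<mapsto> inner w z.\<close>

lemma poly_hull_no_local_peak:
  assumes K: "compact K"
    and z: "z \<in> poly_hull K" and H: "H holomorphic_on ball (ev P z) R" "0 < R"
    and U: "open U" "z \<in> U" "U \<inter> K = {}"
    and le: "\<And>w. w \<in> U \<inter> poly_hull K \<Longrightarrow> ev P w \<in> ball (ev P z) R \<Longrightarrow> Re (H (ev P w)) \<le> Re (H (ev P z))"
    and eq: "\<And>w. w \<in> U \<inter> poly_hull K \<Longrightarrow> ev P w \<in> ball (ev P z) R \<Longrightarrow> Re (H (ev P w)) = Re (H (ev P z)) \<Longrightarrow> norm w \<le> norm z"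
  shows False
proof -
  define a where "a = ev P z"
  have "isCont (ev P) z"
    using continuous_on_ev[OF continuous_on_id, of UNIV P] continuous_on_eq_continuous_at[OF open_UNIV] by blast
  then obtain d1 where d1: "0 < d1" "\<And>w. dist w z < d1 \<Longrightarrow> dist (ev P w) a < R / 2"
    using H(2) unfolding continuous_at_eps_delta a_def by (metis half_gt_zero)
  obtain d2 where d2: "0 < d2" "ball z d2 \<subseteq> U"
    using U(1,2) by (auto simp: open_contains_ball)
  define r where "r = min d1 d2 / 3"
  have r: "0 < r" "2 * r < d1" "2 * r < d2" using d1(1) d2(1) by (auto simp: r_def min_def)
  define D where "D = {w. cmod (fst w - fst z) \<le> r \<and> cmod (snd w - snd z) \<le> r}"
  have D: "w \<in> U" "cmod (ev P w - a) < R / 2" if "w \<in> D" for w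
  proof -
    have "dist w z \<le> cmod (fst w - fst z) + cmod (snd w - snd z)"
      using norm_Pair_le[of "fst w - fst z" "snd w - snd z"] by (simp add: dist_norm minus_prod_def)
    then have "dist w z \<le> 2 * r" using that by (simp add: D_def)
    then have "w \<in> ball z d2" "dist w z < d1" using r by (auto simp: dist_commute)
    then show "w \<in> U" "cmod (ev P w - a) < R / 2"
      using d1(2)[of w] d2(2) by (auto simp: dist_norm)
  qed
  define X where "X = {w \<in> poly_hull K. cmod (fst w - fst z) \<le> r \<and> cmod (snd w - snd z) \<le> r \<and>
    (cmod (fst w - fst z) = r \<or> cmod (snd w - snd z) = r)}"
  have zX: "z \<in> poly_hull X"
    unfolding X_def
  proof (rule poly_hull_bidisc[OF K r(1) z])
    fix w assume "w \<in> K" "cmod (fst w - fst z) \<le> r" "cmod (snd w - snd z) \<le> r"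
    then show False using D(1)[of w] U(3) by (auto simp: D_def)
  qed (use r in auto)
  have XD: "X \<subseteq> D" by (auto simp: X_def D_def)
  have XU: "w \<in> U \<inter> poly_hull K" if "w \<in> X" for w
    using D(1)[OF subsetD[OF XD that]] that by (simp add: X_def)
  have "X = poly_hull K \<inter> ({w. cmod (fst w - fst z) \<le> r} \<inter> {w. cmod (snd w - snd z) \<le> r} \<inter>
      ({w. cmod (fst w - fst z) = r} \<union> {w. cmod (snd w - snd z) = r}))"
    by (auto simp: X_def)
  moreover have "closed \<dots>"
    by (intro closed_Int closed_Un compact_imp_closed[OF compact_poly_hull[OF K]] closed_Collect_le closed_Collect_eq continuous_intros)
  ultimately have X: "compact X"
    using compact_poly_hull[OF K] by (metis compact_Int_closed inf_left_idem)
  define u where "u w = Re (H (ev P w)) - Re (H a)" for w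
  define l where "l w = inner w z - inner z z" for w
  have HX: "ev P w \<in> ball a R" if "w \<in> X" for w
  proof -
    have "cmod (ev P w - a) < R / 2" using D(2) that XD by blast
    then show ?thesis using H(2) by (simp add: dist_norm norm_minus_commute)
  qed
  have contu: "continuous_on X u"
  proof -
    have "continuous_on X (\<lambda>w. H (ev P w))"
      using HX by (intro continuous_on_compose2[OF holomorphic_on_imp_continuous_on[OF H(1)]] continuous_intros)
        (auto simp: a_def)
    then show ?thesis unfolding u_def by (intro continuous_intros)
  qed
  have contl: "continuous_on X l" unfolding l_def by (intro continuous_intros)
  have u0: "u w \<le> 0" if "w \<in> X" for w
  proof -
    have "w \<in> U \<inter> poly_hull K" by (rule XU[OF that])
    then show ?thesis using le[of w] HX[OF that] by (simp add: u_def a_def)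
  qed
  \<comment> \<open>\<open>inner w z \<ge> inner z z\<close> and \<open>norm w \<le> norm z\<close>
    force \<open>w = z\<close>, but every point of \<open>X\<close> has a coordinate at distance
    \<open>r > 0\<close> from that of \<open>z\<close>.\<close>
  have l0: "l w < 0" if "w \<in> X" "u w = 0" for w
  proof (rule ccontr)
    assume l: "\<not> ?thesis"
    have "w \<in> U \<inter> poly_hull K" by (rule XU[OF that(1)])
    then have "norm w \<le> norm z" using eq[of w] HX[OF that(1)] that(2) by (simp add: u_def a_def)
    then have "(norm w)\<^sup>2 \<le> (norm z)\<^sup>2" by (intro power_mono) auto
    then have "inner w w \<le> inner z z" by (simp add: power2_norm_eq_inner)
    moreover have "inner (w - z) (w - z) = inner w w - 2 * inner w z + inner z z"
      by (simp add: inner_diff inner_commute)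
    ultimately have "inner (w - z) (w - z) \<le> 0" using l by (simp add: l_def)
    then have "w - z = 0" by (metis antisym inner_ge_zero inner_eq_zero_iff)
    then have "w = z" by simp
    then show False using that(1) r(1) by (auto simp: X_def)
  qed
  obtain B c where B: "0 \<le> B" "0 < c" "\<And>w. w \<in> X \<Longrightarrow> B * u w + l w \<le> - c"
    using penalty[OF X contu contl u0 l0] by blast
  \<comment> \<open>\<open>Q\<close> replaces H(P) both at \<open>w\<close> and at \<open>z\<close>;
    each replacement costs at most c/4, which leaves c/2 of the gap.\<close>
  define e where "e = c / (4 * (B + 1))"
  have e: "0 < e" "B * e \<le> c / 4"
    using B(1,2) by (auto simp: e_def field_simps)
  obtain b n where b: "\<And>x. cmod (x - a) \<le> R / 2 \<Longrightarrow> cmod ((\<Sum>i<n. b i * (x - a) ^ i) - H x) < e"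
    using holomorphic_approx_ball[of H a R "R/2" e] H e(1) unfolding a_def by auto
  \<comment> \<open>A holomorphic linear form whose real part is the real inner product with
    \<open>z\<close>, so that \<open>l\<close> is the real part of a polynomial.\<close>
  define L where "L = const (cnj (fst z)) * X1 + const (cnj (snd z)) * X2"
  define Q where "Q = (\<Sum>i<n. const (b i) * (P - const a) ^ i)"
  have L: "Re (ev L w) = inner w z" for w
    by (simp add: L_def inner_prod_def inner_complex_def algebra_simps)
  have Q: "\<bar>Re (ev Q w) - Re (H (ev P w))\<bar> < e" if "cmod (ev P w - a) \<le> R / 2" for w
  proof -
    have "cmod (ev Q w - H (ev P w)) < e" using b[OF that] by (simp add: Q_def)
    then show ?thesis using abs_Re_le_cmod[of "ev Q w - H (ev P w)"] by simp
  qed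
  have "Re (ev (const B * Q + L) w) \<le> Re (ev (const B * Q + L) z) - c / 2" if w: "w \<in> X" for w
  proof -
    have "cmod (ev P w - a) \<le> R / 2" using D(2)[OF subsetD[OF XD w]] by simp
    then have "Re (ev Q w) - Re (H (ev P w)) \<le> e" using Q[of w] by simp
    moreover have "Re (H a) - Re (ev Q z) \<le> e" using Q[of z] H(2) by (simp add: a_def)
    ultimately have "B * (Re (ev Q w) - Re (H (ev P w))) \<le> B * e" "B * (Re (H a) - Re (ev Q z)) \<le> B * e"
      using B(1) by (auto intro: mult_left_mono)
    then have "B * Re (ev Q w) - B * Re (ev Q z) \<le> B * u w + c / 2"
      using e(2) by (simp add: u_def algebra_simps)
    then show ?thesis using B(3)[OF w] L[of w] L[of z] by (simp add: l_def)
  qed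
  then show False by (rule poly_hull_Re[OF X zX, rotated]) (use B(2) in simp_all)
qed

section \<open>Conclusion by a positive harmonic function of the logarithm\<close>

theorem theorem1p3:
  fixes P :: "complex \<times> complex \<Rightarrow> complex"
    and K :: "(complex \<times> complex) set"
  assumes "hpoly2 P"
    and "\<forall>z\<in>{z. norm (P z) = 1}. \<exists>D. (P has_derivative D) (at z) \<and> D \<noteq> (\<lambda>h. 0)"
    and "K \<subseteq> {z. norm (P z) = 1}"
    and "compact K"
    and "simply_coconnected K"
    and "\<forall>c. norm c = 1 \<longrightarrow> polynomially_convex (P -` {c} \<inter> K)"
  shows "polynomially_convex K"
proof -
  note K = assms(4)
  obtain p where p: "P = ev p" using assms(1) by (rule hpoly2E)
  have K1: "cmod (ev p w) = 1" if "w \<in> K" for w using assms(3) that p by auto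
  have LK: "z \<in> K" if z: "z \<in> poly_hull K" "cmod (ev p z) = 1" for z
  proof -
    have "z \<in> poly_hull {w \<in> K. ev p w = ev p z}"
      by (rule poly_hull_peak_fibre[OF K K1 z])
    moreover have "{w \<in> K. ev p w = ev p z} = P -` {ev p z} \<inter> K" using p by auto
    moreover have "poly_hull (P -` {ev p z} \<inter> K) = P -` {ev p z} \<inter> K"
      using assms(6) z(2) unfolding polynomially_convex_def by blast
    ultimately show ?thesis by simp
  qed
  have L1: "cmod (ev p z) \<le> 1" if "z \<in> poly_hull K" for z
    by (rule poly_hullD[OF that]) (simp add: K1)
  obtain \<psi> where "continuous_on K \<psi>" "\<And>w. w \<in> K \<Longrightarrow> ev p w = exp (\<psi> w)"
  proof -
    have "continuous_on K P" unfolding p by (intro continuous_on_ev continuous_on_id)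
    moreover have "P ` K \<subseteq> - {0}" using K1 p by force
    ultimately show ?thesis using assms(5) that unfolding simply_coconnected_def p by blast
  qed
  then obtain W \<phi> where W: "open W" "K \<subseteq> W" and \<phi>: "continuous_on W \<phi>" "\<And>w. w \<in> W \<Longrightarrow> ev p w = exp (\<phi> w)"
    using logarithm_near[OF K] by metis
  have "z0 \<in> K" if z0: "z0 \<in> poly_hull K" for z0
  proof (rule ccontr)
    assume "z0 \<notin> K"
    then have Pz0: "cmod (ev p z0) < 1" using LK[OF z0] L1[OF z0] by force
    obtain \<rho> where \<rho>: "0 < \<rho>" "\<rho> < 1" "cmod (ev p z0) < \<rho>" "\<And>w. w \<in> poly_hull K \<Longrightarrow> \<rho> \<le> cmod (ev p w) \<Longrightarrow> w \<in> W"
    proof -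
      obtain m where m: "m < 1" "\<And>w. w \<in> poly_hull K - W \<Longrightarrow> cmod (ev p w) \<le> m"
      proof (cases "poly_hull K - W = {}")
        case True
        then show ?thesis using that[of 0] by auto
      next
        case False
        have c: "compact (poly_hull K - W)" by (intro compact_diff compact_poly_hull K W)
        have "continuous_on (poly_hull K - W) (\<lambda>w. cmod (ev p w))" by (intro continuous_intros)
        then obtain w where w: "w \<in> poly_hull K - W" "\<And>v. v \<in> poly_hull K - W \<Longrightarrow> cmod (ev p v) \<le> cmod (ev p w)"
          using continuous_attains_sup[OF c False] by blast
        have "cmod (ev p w) \<noteq> 1" using w(1) LK W(2) by blast
        then have "cmod (ev p w) < 1" using L1[of w] w(1) by force
        then show ?thesis using that w(2) by blast
      qed
      \<comment> \<open>Above \<open>m\<close>, so that the hull over \<rho> \<le> |P| lies in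
        \<open>W\<close>, where the logarithm is defined; above |P| at \<open>z0\<close>, so that
        \<open>poly_hull_annulus\<close> reaches circles in the open annulus; and below 1.\<close>
      define \<rho> where "\<rho> = (max m (cmod (ev p z0)) + 1) / 2"
      have *: "m < \<rho>" "cmod (ev p z0) < \<rho>" "\<rho> < 1" using m(1) Pz0 by (auto simp: \<rho>_def max_def field_simps)
      show ?thesis
      proof (rule that[OF _ *(3) *(2)])
        show "0 < \<rho>" using *(2) norm_ge_zero[of "ev p z0"] by linarith
        show "w \<in> W" if "w \<in> poly_hull K" "\<rho> \<le> cmod (ev p w)" for w
          using m(2)[of w] *(1) that by (cases "w \<in> W") auto
      qed
    qed
    define A where "A = {w \<in> poly_hull K. \<rho> \<le> cmod (ev p w)}"
    have AW: "A \<subseteq> W" using \<rho>(4) by (auto simp: A_def)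
    have "A = poly_hull K \<inter> {w. \<rho> \<le> cmod (ev p w)}" by (auto simp: A_def)
    moreover have "closed {w. \<rho> \<le> cmod (ev p w)}" by (intro closed_Collect_le continuous_intros)
    ultimately have A: "compact A" using compact_poly_hull[OF K] by (simp add: compact_Int_closed)
    have ln\<rho>: "ln \<rho> < 0" using \<rho> by simp
    define \<kappa> where "\<kappa> = - pi / ln \<rho>"
    have \<kappa>: "0 < \<kappa>" "\<kappa> * ln \<rho> = - pi" using ln\<rho> by (auto simp: \<kappa>_def divide_pos_neg field_simps)
    define h where "h s = - \<i> * exp (- \<i> * \<kappa> * s)" for s
    have h: "Re (h s) = - exp (\<kappa> * Im s) * sin (\<kappa> * Re s)" for s
      by (simp add: h_def Re_exp Im_exp)
    define v where "v w = Re (h (\<phi> w))" for w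
    have Re\<phi>: "Re (\<phi> w) = ln (cmod (ev p w))" if "w \<in> A" for w
      using \<phi>(2)[of w] that AW by auto
    have contv: "continuous_on A v"
      unfolding v_def h_def by (intro continuous_intros continuous_on_subset[OF \<phi>(1) AW])
    have v_pos: "0 < v w" if w: "w \<in> A" "\<rho> < cmod (ev p w)" "cmod (ev p w) < 1" for w
    proof -
      have "ln \<rho> < Re (\<phi> w)" "Re (\<phi> w) < 0"
        using w \<rho>(1) order_less_trans[OF \<rho>(1) w(2)] unfolding Re\<phi>[OF w(1)]
        by (simp_all only: ln_less_cancel_iff ln_less_zero_iff)
      then have "\<kappa> * ln \<rho> < \<kappa> * Re (\<phi> w)" "\<kappa> * Re (\<phi> w) < 0"
        using \<kappa>(1) by (auto simp: mult_pos_neg)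
      then have "0 < sin (- (\<kappa> * Re (\<phi> w)))" using \<kappa>(2) by (intro sin_gt_zero) linarith+
      then show ?thesis by (simp add: v_def h mult_pos_neg)
    qed
    have v_zero: "v w = 0" if w: "w \<in> A" "\<not> (\<rho> < cmod (ev p w) \<and> cmod (ev p w) < 1)" for w
    proof -
      have "cmod (ev p w) = \<rho> \<or> cmod (ev p w) = 1"
        using w L1[of w] by (auto simp: A_def)
      then have "\<kappa> * Re (\<phi> w) = - pi \<or> Re (\<phi> w) = 0"
        using Re\<phi>[OF w(1)] \<kappa>(2) by auto
      then show ?thesis by (auto simp: v_def h)
    qed
    \<comment> \<open>A point of the hull over the middle of the annulus makes the maximum of
      \<open>v\<close> positive, which excludes the two boundary circles.\<close>
    obtain w1 where w1: "w1 \<in> poly_hull K" "cmod (ev p w1) = (\<rho> + 1) / 2"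
      using poly_hull_annulus[OF K K1 z0, of "(\<rho> + 1) / 2"] \<rho> by auto
    have w1A: "w1 \<in> A" "0 < v w1"
      using w1 \<rho> v_pos[of w1] by (auto simp: A_def)
    obtain w2 where w2: "w2 \<in> A" "\<And>w. w \<in> A \<Longrightarrow> v w \<le> v w2"
      using continuous_attains_sup[OF A _ contv] w1A by blast
    have "{w \<in> A. v w = v w2} = A \<inter> v -` {v w2}" by auto
    then have F: "compact {w \<in> A. v w = v w2}"
      using closedin_compact[OF A continuous_closedin_preimage[OF contv closed_singleton]] by simp
    obtain z where z: "z \<in> A" "v z = v w2" "\<And>w. w \<in> A \<Longrightarrow> v w = v w2 \<Longrightarrow> norm w \<le> norm z"
    proof -
      have "continuous_on {w \<in> A. v w = v w2} norm" by (intro continuous_intros)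
      then show ?thesis using continuous_attains_sup[OF F] w2(1) that by blast
    qed
    have "0 < v z" using w2(2)[OF w1A(1)] w1A(2) z(2) by linarith
    then have Pz: "\<rho> < cmod (ev p z)" "cmod (ev p z) < 1" using v_zero[OF z(1)] by force+
    define R where "R = cmod (ev p z)"
    \<comment> \<open>The branch of the logarithm that agrees with \<phi> at \<open>z\<close>. On
      the disc of radius |P z| about P z the quotient has positive real part, so the principal
      \<open>Ln\<close> is holomorphic there.\<close>
    define \<Lambda> where "\<Lambda> x = \<phi> z + Ln (x / ev p z)" for x
    have z0': "ev p z \<noteq> 0" using Pz \<rho> by auto
    have Ln: "x / ev p z \<notin> \<real>\<^sub>\<le>\<^sub>0" if "x \<in> ball (ev p z) R" for x
    proof -
      have "cmod (1 - x / ev p z) = cmod (ev p z - x) / R"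
        using z0' by (simp add: R_def diff_divide_distrib flip: norm_divide)
      also have "\<dots> < 1" using that z0' by (simp add: R_def dist_norm)
      finally have "0 < Re (x / ev p z)"
        using abs_Re_le_cmod[of "1 - x / ev p z"] by simp
      then show ?thesis by (auto simp: complex_nonpos_Reals_iff)
    qed
    have \<Lambda>_hol: "\<Lambda> holomorphic_on ball (ev p z) R"
      unfolding \<Lambda>_def using Ln z0' by (intro holomorphic_intros) auto
    \<comment> \<open>The condition \<rho> < |P| < 1 keeps the neighbourhood off \<open>K\<close>
      and puts its hull points into \<open>A\<close>, where \<open>z\<close> is known to be
      maximal.\<close>
    define W' where "W' = W \<inter> ev p -` (ball (ev p z) R \<inter> {x. \<rho> < cmod x} \<inter> {x. cmod x < 1})"
    have W': "open W'" unfolding W'_def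
      by (intro continuous_open_preimage W continuous_on_ev continuous_on_id open_Int open_ball open_Collect_less continuous_intros)
    \<comment> \<open>\<phi> and \<Lambda> of P have the same exponential, so they differ by a
      multiple of 2 pi \<i>; this open window, which contains \<open>z\<close>, leaves only the
      multiple 0.\<close>
    define U where "U = W' \<inter> (\<lambda>w. Im (\<phi> w) - Im (\<Lambda> (ev p w))) -` {-2*pi<..<2*pi}"
    have "continuous_on W' (\<lambda>w. \<Lambda> (ev p w))"
      by (intro continuous_on_compose2[OF holomorphic_on_imp_continuous_on[OF \<Lambda>_hol]] continuous_intros)
        (auto simp: W'_def)
    moreover have "continuous_on W' \<phi>" by (rule continuous_on_subset[OF \<phi>(1)]) (auto simp: W'_def)
    ultimately have U: "open U"
      unfolding U_def by (intro continuous_open_preimage continuous_intros W')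
    have h\<Lambda>: "h (\<Lambda> (ev p w)) = h (\<phi> w)" if "w \<in> U" for w
    proof -
      have w: "w \<in> W" "\<rho> < cmod (ev p w)" using that by (auto simp: U_def W'_def)
      have "ev p w \<noteq> 0" using w(2) \<rho>(1) by auto
      then have "exp (\<Lambda> (ev p w)) = exp (\<phi> z) * (ev p w / ev p z)"
        using z0' by (simp add: \<Lambda>_def exp_add)
      also have "exp (\<phi> z) = ev p z" using \<phi>(2)[of z] z(1) AW by auto
      finally have "exp (\<phi> w) = exp (\<Lambda> (ev p w))" using \<phi>(2)[OF w(1)] z0' by simp
      moreover have "\<bar>Im (\<phi> w) - Im (\<Lambda> (ev p w))\<bar> < 2 * pi" using that by (auto simp: U_def)
      ultimately show ?thesis using exp_complex_eqI by metis
    qed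
    have UA: "w \<in> A" if "w \<in> U \<inter> poly_hull K" for w
      using that by (auto simp: U_def W'_def A_def)
    have zU: "z \<in> U" using z(1) AW Pz z0' by (auto simp: U_def W'_def \<Lambda>_def R_def)
    show False
    proof (rule poly_hull_no_local_peak[OF K _ _ _ U zU])
      show "z \<in> poly_hull K" using z(1) by (simp add: A_def)
      show "(\<lambda>x. h (\<Lambda> x)) holomorphic_on ball (ev p z) R"
        unfolding h_def by (intro holomorphic_intros \<Lambda>_hol)
      show "0 < R" using z0' by (simp add: R_def)
      show "U \<inter> K = {}" using K1 by (force simp: U_def W'_def)
      show "Re (h (\<Lambda> (ev p w))) \<le> Re (h (\<Lambda> (ev p z)))" if "w \<in> U \<inter> poly_hull K" for w
        using w2(2)[OF UA[OF that]] z(2) h\<Lambda>[of w] h\<Lambda>[OF zU] that by (simp add: v_def)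
      show "norm w \<le> norm z" if "w \<in> U \<inter> poly_hull K" "Re (h (\<Lambda> (ev p w))) = Re (h (\<Lambda> (ev p z)))" for w
        using z(3)[OF UA[OF that(1)]] z(2) h\<Lambda>[of w] h\<Lambda>[OF zU] that by (simp add: v_def)
    qed
  qed
  then show ?thesis unfolding polynomially_convex_def using subset_poly_hull[of K] by blast
qed

end
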